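(* Let $p>3$ be a prime, let $a\in\mathbb Z_p$ with $a\not\equiv 0\pmod p$, and put $t=(a-\langle a\rangle_p)/p$. Then $$\sum_{k=1}^{p-1}\frac{1}{k}\binom ak\binom{-1-a}k\equiv -\frac 23p^2t(t+1)B_{p-3}(-a)-2\,\frac{B_{p^2(p-1)}(-a)-B_{p^2(p-1)}}{p^2(p-1)}\pmod{p^3}.$$
   Context: $\mathbb Z_p$ denotes the set of rational numbers whose denominator is not divisible by $p$. For $x,y\in\mathbb Q$, $x\equiv y\pmod{p^m}$ means $(x-y)/p^m\in\mathbb Z_p$. For $a\in\mathbb Z_p$, $\langle a\rangle_p\in\{0,1,\ldots,p-1\}$ is defined by $a\equiv\langle a\rangle_p\pmod p$. For rational $a$ and integer $k\ge0$, $\binom ak=a(a-1)\cdots(a-k+1)/k!$. The Bernoulli numbers are defined by $B_0=1$, $\sum_{k=0}^{n-1}\binom nkB_k=0$ for $n\ge2$, and the Bernoulli polynomials by $B_n(x)=\sum_{k=0}^n\binom nkB_kx^{n-k}$. *)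

theory Defs
  imports Complex_Main "HOL-Computational_Algebra.Primes"
begin

definition Zp :: "nat \<Rightarrow> rat set" where
  "Zp p = {x. \<not> int p dvd snd (quotient_of x)}"

(* qcong p m x y: x is congruent to y modulo p^m in the sense of p-integral rationals *)
definition qcong :: "nat \<Rightarrow> nat \<Rightarrow> rat \<Rightarrow> rat \<Rightarrow> bool" where
  "qcong p m x y \<longleftrightarrow> (x - y) / of_nat p ^ m \<in> Zp p"

(* the least non-negative residue; meaningful for p prime and a in Zp p (see least_residue_ex1) *)
definition least_residue :: "nat \<Rightarrow> rat \<Rightarrow> int" where
  "least_residue p a = (THE r. 0 \<le> r \<and> r < int p \<and> qcong p 1 a (of_int r))"

(* The implicit recursion of the Bernoulli numbers, solved for the term of highest index;
   bernoulli_recurrence below recovers the implicit form. *)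
fun bernoulli :: "nat \<Rightarrow> rat" where
  "bernoulli 0 = 1"
| "bernoulli (Suc n) =
     - (\<Sum>k\<le>n. of_nat (Suc (Suc n) choose k) * bernoulli k) / of_nat (Suc (Suc n))"

definition bernpoly :: "nat \<Rightarrow> rat \<Rightarrow> rat" where
  "bernpoly n x = (\<Sum>k\<le>n. of_nat (n choose k) * bernoulli k * x ^ (n - k))"

lemma bernoulli_recurrence:
  assumes "n \<ge> 2"
  shows "(\<Sum>k<n. of_nat (n choose k) * bernoulli k) = 0"
proof -
  obtain m where n: "n = Suc (Suc m)"
    using assms by (metis Suc_le_D numeral_2_eq_2 Suc_le_mono)
  have "{..<n} = insert (Suc m) {..m}" by (auto simp: n)
  moreover have "(of_nat (Suc (Suc m)) :: rat) \<noteq> 0" by (simp only: of_nat_eq_0_iff)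
  moreover have "n choose Suc m = Suc (Suc m)" unfolding n by simp
  ultimately show ?thesis by (simp add: n del: of_nat_Suc binomial_Suc_Suc)
qed

lemma Zp_iff:
  assumes "prime p"
  shows "x \<in> Zp p \<longleftrightarrow> (\<exists>u v. \<not> int p dvd v \<and> x = of_int u / of_int v)"
proof
  assume "x \<in> Zp p"
  then show "\<exists>u v. \<not> int p dvd v \<and> x = of_int u / of_int v"
    by (metis (mono_tags, lifting) Zp_def mem_Collect_eq prod.collapse quotient_of_div)
next
  assume "\<exists>u v. \<not> int p dvd v \<and> x = of_int u / of_int v"
  then obtain u v where uv: "\<not> int p dvd v" "x = of_int u / of_int v" by blast
  obtain c d where cd: "quotient_of x = (c, d)" by fastforce
  have d: "d > 0" "coprime c d" "x = of_int c / of_int d"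
    using cd quotient_of_denom_pos quotient_of_coprime quotient_of_div by blast+
  have "v \<noteq> 0" using uv(1) by auto
  have "(of_int (c * v) :: rat) = of_int (u * d)"
    using d uv \<open>v \<noteq> 0\<close> by (simp add: field_simps)
  then have "c * v = u * d" by (simp only: of_int_eq_iff)
  then have "d dvd c * v" by simp
  then have "d dvd v" using d(2) by (metis coprime_commute coprime_dvd_mult_right_iff)
  then have "\<not> int p dvd d" using uv(1) dvd_trans by blast
  then show "x \<in> Zp p" by (simp add: Zp_def cd)
qed

lemma qcong_1_of_int:
  assumes "prime p" "\<not> int p dvd v"
  shows "qcong p 1 (of_int u / of_int v) (of_int r) \<longleftrightarrow> int p dvd u - r * v"
proof -
  have p0: "(of_nat p :: rat) \<noteq> 0" using assms(1) by (auto dest: prime_gt_0_nat)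
  have v0: "v \<noteq> 0" using assms(2) by auto
  show ?thesis
  proof
    assume "qcong p 1 (of_int u / of_int v) (of_int r)"
    then obtain s w where sw: "\<not> int p dvd w"
        "(of_int u / of_int v - of_int r) / of_nat p = (of_int s / of_int w :: rat)"
      unfolding qcong_def Zp_iff[OF assms(1)] by auto
    have "w \<noteq> 0" using sw(1) by auto
    then have "(of_int ((u - r * v) * w) :: rat) = of_int (int p * (s * v))"
      using sw(2) p0 v0 by (simp add: field_simps)
    then have "(u - r * v) * w = int p * (s * v)" by (simp only: of_int_eq_iff)
    then have "int p dvd (u - r * v) * w" by simp
    then show "int p dvd u - r * v" using sw(1) assms(1) by (simp add: prime_dvd_mult_iff)
  next
    assume "int p dvd u - r * v"
    then obtain s where s: "u - r * v = int p * s" by blast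
    have "(of_int (u - r * v) :: rat) = of_int (int p * s)" by (simp only: s)
    then have "(of_int u / of_int v - of_int r) / of_nat p ^ 1 = (of_int s / of_int v :: rat)"
      using p0 v0 by (simp add: field_simps)
    then show "qcong p 1 (of_int u / of_int v) (of_int r)"
      unfolding qcong_def Zp_iff[OF assms(1)] using assms(2) by blast
  qed
qed

lemma least_residue_ex1:
  assumes p: "prime p" and a: "a \<in> Zp p"
  shows "\<exists>!r. 0 \<le> r \<and> r < int p \<and> qcong p 1 a (of_int r)"
proof -
  obtain u v where uv: "\<not> int p dvd v" "a = of_int u / of_int v"
    using a Zp_iff[OF p] by blast
  have p0: "int p > 0" using p by (simp add: prime_gt_0_nat)
  have "coprime (int p) v" using p uv(1) by (simp add: prime_imp_coprime)
  then obtain x y where xy: "int p * x + v * y = 1"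
    using bezout_int[of "int p" v] by (metis coprime_imp_gcd_eq_1 mult.commute)
  define r where "r = (u * y) mod int p"
  have "r = u * y - int p * (u * y div int p)" by (simp add: r_def minus_mult_div_eq_mod)
  then have "u - r * v = u * (int p * x + v * y) - (u * y - int p * (u * y div int p)) * v"
    using xy by simp
  also have "\<dots> = int p * (u * x + (u * y div int p) * v)" by (simp add: algebra_simps)
  finally have r: "int p dvd u - r * v" by simp
  show ?thesis
  proof (rule ex1I[of _ r])
    show "0 \<le> r \<and> r < int p \<and> qcong p 1 a (of_int r)"
      using r p0 qcong_1_of_int[OF p uv(1)] uv(2) by (simp add: r_def)
    fix s assume s: "0 \<le> s \<and> s < int p \<and> qcong p 1 a (of_int s)"
    then have "int p dvd u - s * v" using qcong_1_of_int[OF p uv(1)] uv(2) by simp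
    then have "int p dvd (u - s * v) - (u - r * v)" using r dvd_diff by blast
    then have "int p dvd (r - s) * v" by (simp add: algebra_simps)
    then have "int p dvd r - s" using p uv(1) by (simp add: prime_dvd_mult_iff)
    then have "r mod int p = s mod int p" by (simp add: mod_eq_dvd_iff)
    then show "s = r" using s p0 by (simp add: r_def)
  qed
qed

end

(*
  Write f(a) for the sum and P_n(x) for the product of the factors 1 - x^2/i^2 with 1 <= i <= n.
  The k-th product of binomial coefficients equals - a (a + k) / k^2 * P_{k-1}(a), which gives the
  telescoping relation f(a) - f(a - 1) = 2/a * (P_{p-1}(a) - 1).  With r = <a>_p, the sum is reduced
  in r steps to f(pt).  Modulo p^3, P_{p-1}(pt + j) is p^2 t (t + 1) / (pt + j)^2 because exactly two
  linear factors are divisible by p, and f(pt) is - p^2 t B_{N-2} with N = p^2 (p - 1).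
  On the other side, B_n(x + 1) - B_n(x) = n x^(n-1) carries B_N(-a) and B_{p-3}(-a) to the argument
  -pt in the same r steps, and there the Taylor expansion together with p B_k in Z_p leaves only the
  term with B_{N-2}.  The two sides match by Kummer's congruence 3 B_{N-2} = 2 B_{p-3} (mod p).
*)
theory Submission
  imports Defs "HOL-Number_Theory.Number_Theory" "HOL-Computational_Algebra.Formal_Power_Series"
begin

unbundle fps_syntax

section \<open>Bernoulli polynomials\<close>

definition bernoulli_egf :: "rat fps" where
  "bernoulli_egf = Abs_fps (\<lambda>n. bernoulli n / fact n)"

text \<open>This is the recurrence of the Bernoulli numbers, read coefficient by coefficient. The
  product form replaces the quotient X/(e^X - 1), because \<open>fps_exp 1 - 1\<close> has constant
  term 0 and hence no inverse.\<close>

lemma bernoulli_egf_times_exp: "bernoulli_egf * (fps_exp 1 - 1) = fps_X"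
proof (rule fps_ext)
  fix n
  have "(bernoulli_egf * (fps_exp 1 - 1)) $ n =
      (\<Sum>i=0..n. bernoulli i / fact i * (1 / fact (n - i) - (if n - i = 0 then 1 else 0)))"
    by (simp add: fps_mult_nth bernoulli_egf_def)
  \<comment> \<open>The term with i = n vanishes because 1/0! - 1 = 0.\<close>
  also have "\<dots> = (\<Sum>i<n. bernoulli i / fact i * (1 / fact (n - i) - (if n - i = 0 then 1 else 0)))"
    by (rule sum.mono_neutral_right) (auto simp: le_less not_less)
  also have "\<dots> = (\<Sum>i<n. of_nat (n choose i) * bernoulli i / fact n)"
    by (rule sum.cong) (auto simp: binomial_fact field_simps)
  also have "\<dots> = (\<Sum>i<n. of_nat (n choose i) * bernoulli i) / fact n"
    by (simp add: sum_divide_distrib)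
  also have "\<dots> = (fps_X :: rat fps) $ n"
  proof -
    consider "n = 0" | "n = 1" | "n \<ge> 2" by linarith
    then show ?thesis by cases (auto simp: bernoulli_recurrence fps_X_def)
  qed
  finally show "(bernoulli_egf * (fps_exp 1 - 1)) $ n = (fps_X :: rat fps) $ n" .
qed

lemma bernpoly_egf: "Abs_fps (\<lambda>n. bernpoly n x / fact n) = bernoulli_egf * fps_exp x"
proof (rule fps_ext)
  fix n
  have "(bernoulli_egf * fps_exp x) $ n =
      (\<Sum>i\<le>n. bernoulli i / fact i * (x ^ (n - i) / fact (n - i)))"
    by (simp add: fps_mult_nth bernoulli_egf_def atLeast0AtMost)
  also have "\<dots> = (\<Sum>i\<le>n. of_nat (n choose i) * bernoulli i * x ^ (n - i) / fact n)"
    by (rule sum.cong) (auto simp: binomial_fact field_simps)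
  finally show "Abs_fps (\<lambda>n. bernpoly n x / fact n) $ n = (bernoulli_egf * fps_exp x) $ n"
    by (simp add: bernpoly_def sum_divide_distrib)
qed

text \<open>Since e^((x+1)X) - e^(xX) = (e^X - 1) e^(xX), the denominator of the generating function
  cancels and X e^(xX) remains.\<close>

lemma bernpoly_add_one: "bernpoly (Suc n) (x + 1) - bernpoly (Suc n) x = of_nat (Suc n) * x ^ n"
proof -
  have "bernoulli_egf * fps_exp (x + 1) - bernoulli_egf * fps_exp x
      = bernoulli_egf * (fps_exp 1 - 1) * fps_exp x"
    by (simp add: fps_exp_add_mult algebra_simps)
  then have "(bernoulli_egf * fps_exp (x + 1)) $ Suc n - (bernoulli_egf * fps_exp x) $ Suc n
      = (fps_X * fps_exp x) $ Suc n"
    by (simp only: bernoulli_egf_times_exp flip: fps_sub_nth)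
  then have "bernpoly (Suc n) (x + 1) / fact (Suc n) - bernpoly (Suc n) x / fact (Suc n)
      = x ^ n / fact n"
    by (simp only: fps_nth_Abs_fps fps_X_mult_nth fps_exp_nth flip: bernpoly_egf) simp
  then have "fact n * (bernpoly (Suc n) (x + 1) - bernpoly (Suc n) x) = fact n * (of_nat (Suc n) * x ^ n)"
    by (simp add: field_simps del: of_nat_Suc)
  then show ?thesis by simp
qed

lemma bernpoly_add_nat:
  "bernpoly (Suc n) (x + of_nat m) - bernpoly (Suc n) x = of_nat (Suc n) * (\<Sum>j<m. (x + of_nat j) ^ n)"
proof (induction m)
  case (Suc m)
  then show ?case using bernpoly_add_one[of n "x + of_nat m"]
    by (simp add: algebra_simps del: of_nat_Suc) (simp add: algebra_simps)
qed simp

text \<open>Telescoping leads from -(x + r) up to -x. The plus sign arises because the exponent is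
  odd, so each negative base yields -(x + j)^n. In this form the values at -a are carried to
  -pt.\<close>

lemma bernpoly_minus_shift:
  assumes "odd n"
  shows "bernpoly (Suc n) (- (x + of_nat r)) =
    bernpoly (Suc n) (- x) + of_nat (Suc n) * (\<Sum>j=1..r. (x + of_nat j) ^ n)"
proof -
  have "(\<Sum>j<r. (- (x + of_nat r) + of_nat j) ^ n) = (\<Sum>j=1..r. - ((x + of_nat j) ^ n))"
    by (rule sum.reindex_bij_witness[of _ "\<lambda>j. r - j" "\<lambda>j. r - j"])
      (use assms in \<open>auto simp: of_nat_diff algebra_simps simp flip: power_minus_odd\<close>)
  then show ?thesis
    using bernpoly_add_nat[of n "- (x + of_nat r)" r] by (simp add: sum_negf algebra_simps del: of_nat_Suc)
qed

text \<open>Substituting -X turns X/(e^X - 1) into X e^X/(e^X - 1). The two series differ by X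
  alone, so every odd coefficient other than that of X is its own negative.\<close>

lemma bernoulli_odd:
  assumes "odd n" "n \<noteq> 1"
  shows "bernoulli n = 0"
proof -
  let ?b = "bernoulli_egf" and ?c = "bernoulli_egf oo (- fps_X)"
  have "?c * (fps_exp (- 1) - 1) = - fps_X"
    using arg_cong[OF bernoulli_egf_times_exp, of "\<lambda>f. f oo (- fps_X)"]
    by (simp add: fps_compose_mult_distrib fps_compose_sub_distrib)
  then have "?c * (fps_exp (- 1) - 1) * fps_exp 1 = - fps_X * fps_exp 1" by simp
  then have "?c * (fps_exp (- 1) * fps_exp 1 - fps_exp 1) = - fps_X * fps_exp 1"
    by (simp add: algebra_simps)
  then have "?c * (1 - fps_exp 1) = - fps_X * fps_exp 1"
    by (simp flip: fps_exp_add_mult)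
  then have "?c * (fps_exp 1 - 1) = fps_X * fps_exp 1"
    by (simp add: algebra_simps)
  then have "(?c - ?b) * (fps_exp 1 - 1) = fps_X * (fps_exp 1 - 1)"
    using bernoulli_egf_times_exp by (simp add: algebra_simps)
  moreover have "fps_exp (1::rat) - 1 \<noteq> 0" by simp
  ultimately have "?c - ?b = fps_X" by (metis mult_right_cancel)
  then have "(?c - ?b) $ n = 0" using assms(2) by (simp add: fps_X_nth)
  then show ?thesis using assms(1)
    by (simp add: fps_compose_uminus' bernoulli_egf_def)
qed

text \<open>The absorption identity for binomials extracts the factor \<open>Suc n\<close>. It can
  then be cancelled exactly, which matters when \<open>Suc n\<close> is N, a multiple of
  p^2.\<close>

lemma bernpoly_expand:
  "bernpoly (Suc n) x - bernoulli (Suc n) =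
    of_nat (Suc n) * (\<Sum>k\<le>n. of_nat (n choose k) * bernoulli (n - k) * x ^ Suc k / of_nat (Suc k))"
proof -
  have "bernpoly (Suc n) x = (\<Sum>k\<le>Suc n. of_nat (Suc n choose k) * bernoulli (Suc n - k) * x ^ k)"
    unfolding bernpoly_def
    by (rule sum.reindex_bij_witness[of _ "\<lambda>k. Suc n - k" "\<lambda>k. Suc n - k"])
      (auto simp: binomial_symmetric[symmetric] simp del: binomial_Suc_Suc)
  also have "\<dots> = bernoulli (Suc n) +
      (\<Sum>k\<le>n. of_nat (Suc n choose Suc k) * bernoulli (n - k) * x ^ Suc k)"
    by (simp add: sum.atMost_Suc_shift del: binomial_Suc_Suc sum.atMost_Suc bernoulli.simps)
  also have "(\<Sum>k\<le>n. of_nat (Suc n choose Suc k) * bernoulli (n - k) * x ^ Suc k) =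
     (\<Sum>k\<le>n. of_nat (Suc n) * (of_nat (n choose k) * bernoulli (n - k) * x ^ Suc k / of_nat (Suc k)))"
  proof (rule sum.cong)
    fix k
    have "of_nat (Suc k) * of_nat (Suc n choose Suc k) = (of_nat (Suc n) * of_nat (n choose k) :: rat)"
      by (simp only: Suc_times_binomial flip: of_nat_mult)
    then have "of_nat (Suc n choose Suc k) = (of_nat (Suc n) * of_nat (n choose k) / of_nat (Suc k) :: rat)"
      by (simp add: eq_divide_eq mult.commute del: binomial_Suc_Suc of_nat_Suc)
    then show "of_nat (Suc n choose Suc k) * bernoulli (n - k) * x ^ Suc k =
      of_nat (Suc n) * (of_nat (n choose k) * bernoulli (n - k) * x ^ Suc k / of_nat (Suc k))"
      by (simp only: times_divide_eq_left times_divide_eq_right mult.assoc)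
  qed simp
  finally show ?thesis by (simp only: sum_distrib_left)
qed

section \<open>Congruences between p-integral rationals\<close>

locale prime_congruences =
  fixes p :: nat
  assumes prime_p: "prime p"
begin

lemma p_pos [simp]: "p > 0" "p \<noteq> 0"
  using prime_p by (auto dest: prime_gt_0_nat)

lemma prime_int: "prime (int p)" using prime_p by simp

lemma Zp_fraction: "\<not> int p dvd v \<Longrightarrow> of_int u / of_int v \<in> Zp p"
  using Zp_iff[OF prime_p] by blast

lemma Zp_cases:
  assumes "x \<in> Zp p"
  obtains u v where "\<not> int p dvd v" "v \<noteq> 0" "x = of_int u / of_int v"
  using assms Zp_iff[OF prime_p] by (metis dvd_0_right)

lemma Zp_of_int [simp, intro]: "of_int u \<in> Zp p"
  using Zp_fraction[of 1 u] prime_p by (auto simp: prime_nat_iff)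

lemma Zp_of_nat [simp, intro]: "of_nat u \<in> Zp p"
  using Zp_of_int[of "int u"] by simp

lemma Zp_numeral [simp, intro]: "numeral u \<in> Zp p"
  using Zp_of_nat[of "numeral u"] by simp

lemma Zp_0 [simp, intro]: "0 \<in> Zp p"
  using Zp_of_nat[of 0] by simp

lemma Zp_1 [simp, intro]: "1 \<in> Zp p"
  using Zp_of_nat[of 1] by simp

lemma Zp_add [intro]:
  assumes "x \<in> Zp p" "y \<in> Zp p" shows "x + y \<in> Zp p"
proof -
  obtain u v u' v' where *: "\<not> int p dvd v" "v \<noteq> 0" "x = of_int u / of_int v"
    "\<not> int p dvd v'" "v' \<noteq> 0" "y = of_int u' / of_int v'"
    using assms by (metis Zp_cases)
  then have "x + y = of_int (u * v' + u' * v) / of_int (v * v')"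
    by (simp add: field_simps)
  then show ?thesis using * Zp_fraction prime_int by (metis prime_dvd_mult_iff)
qed

lemma Zp_mult [intro]:
  assumes "x \<in> Zp p" "y \<in> Zp p" shows "x * y \<in> Zp p"
proof -
  obtain u v u' v' where *: "\<not> int p dvd v" "v \<noteq> 0" "x = of_int u / of_int v"
    "\<not> int p dvd v'" "v' \<noteq> 0" "y = of_int u' / of_int v'"
    using assms by (metis Zp_cases)
  then have "x * y = of_int (u * u') / of_int (v * v')"
    by simp
  then show ?thesis using * Zp_fraction prime_int by (metis prime_dvd_mult_iff)
qed

lemma Zp_uminus [intro]: "x \<in> Zp p \<Longrightarrow> - x \<in> Zp p"
  using Zp_mult[OF Zp_of_int[of "- 1"], of x] by simp

lemma Zp_diff [intro]: "x \<in> Zp p \<Longrightarrow> y \<in> Zp p \<Longrightarrow> x - y \<in> Zp p"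
  using Zp_add[of x "- y"] by auto

lemma Zp_power [intro]: "x \<in> Zp p \<Longrightarrow> x ^ n \<in> Zp p"
  by (induction n) auto

lemma Zp_sum [intro]: "(\<And>i. i \<in> A \<Longrightarrow> f i \<in> Zp p) \<Longrightarrow> sum f A \<in> Zp p"
  by (induction A rule: infinite_finite_induct) auto

lemma Zp_prod [intro]: "(\<And>i. i \<in> A \<Longrightarrow> f i \<in> Zp p) \<Longrightarrow> prod f A \<in> Zp p"
  by (induction A rule: infinite_finite_induct) auto

lemma Zp_inverse_of_nat: "\<not> p dvd n \<Longrightarrow> 1 / of_nat n \<in> Zp p"
  using Zp_fraction[of "int n" 1] by simp

lemma qcong_refl [simp, intro]: "qcong p m x x"
  by (simp add: qcong_def)

lemma qcong_sym: "qcong p m x y \<Longrightarrow> qcong p m y x"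
  unfolding qcong_def using Zp_uminus by (metis minus_diff_eq minus_divide_left)

lemma qcong_trans [trans]: "qcong p m x y \<Longrightarrow> qcong p m y z \<Longrightarrow> qcong p m x z"
  unfolding qcong_def using Zp_add[of "(x - y) / of_nat p ^ m" "(y - z) / of_nat p ^ m"]
  by (simp flip: add_divide_distrib)

lemma qcong_add: "qcong p m x y \<Longrightarrow> qcong p m x' y' \<Longrightarrow> qcong p m (x + x') (y + y')"
  unfolding qcong_def using Zp_add[of "(x - y) / of_nat p ^ m" "(x' - y') / of_nat p ^ m"]
  by (simp add: algebra_simps flip: add_divide_distrib)

lemma qcong_uminus: "qcong p m x y \<Longrightarrow> qcong p m (- x) (- y)"
  unfolding qcong_def using Zp_uminus[of "(x - y) / of_nat p ^ m"]
  by (simp add: minus_divide_left)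

lemma qcong_diff: "qcong p m x y \<Longrightarrow> qcong p m x' y' \<Longrightarrow> qcong p m (x - x') (y - y')"
  using qcong_add[OF _ qcong_uminus, of m x y x' y'] by simp

lemma qcong_sum: "(\<And>i. i \<in> A \<Longrightarrow> qcong p m (f i) (g i)) \<Longrightarrow> qcong p m (sum f A) (sum g A)"
  by (induction A rule: infinite_finite_induct) (auto intro: qcong_add)

lemma qcong_cmult: "qcong p m x y \<Longrightarrow> c \<in> Zp p \<Longrightarrow> qcong p m (c * x) (c * y)"
  unfolding qcong_def using Zp_mult[of c "(x - y) / of_nat p ^ m"]
  by (simp add: algebra_simps)

lemma qcong_mult:
  assumes "qcong p m x y" "qcong p m x' y'" "x \<in> Zp p" "y' \<in> Zp p"
  shows "qcong p m (x * x') (y * y')"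
  \<comment> \<open>The chain passes through \<open>x * y'\<close>, which explains the two
    integrality assumptions.\<close>
  using qcong_trans[OF qcong_cmult[OF assms(2,3)] qcong_cmult[OF assms(1,4), simplified mult.commute[of y']]]
  by (simp add: mult.commute)

lemma qcong_power:
  assumes "qcong p m x y" "x \<in> Zp p" "y \<in> Zp p"
  shows "qcong p m (x ^ n) (y ^ n)"
  by (induction n) (auto intro!: qcong_mult assms)

lemma qcong_prod:
  assumes "\<And>i. i \<in> A \<Longrightarrow> qcong p m (f i) (g i)" "\<And>i. i \<in> A \<Longrightarrow> f i \<in> Zp p"
    "\<And>i. i \<in> A \<Longrightarrow> g i \<in> Zp p"
  shows "qcong p m (prod f A) (prod g A)"
  using assms by (induction A rule: infinite_finite_induct) (auto intro!: qcong_mult)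

lemma qcong_mono:
  assumes "qcong p n x y" "m \<le> n" shows "qcong p m x y"
proof -
  have "(x - y) / of_nat p ^ m = of_nat (p ^ (n - m)) * ((x - y) / of_nat p ^ n)"
    using assms(2) by (simp add: field_simps flip: power_add)
  then show ?thesis using assms(1) Zp_mult by (metis Zp_of_nat qcong_def)
qed

text \<open>An explicit factor p^n contributes n to the precision. Applications write the modulus as
  a sum such as \<open>1 + 2\<close> so that this equivalence can rewrite it.\<close>

lemma qcong_shift: "qcong p (n + m) (of_nat p ^ n * x) (of_nat p ^ n * y) \<longleftrightarrow> qcong p m x y"
  by (simp add: qcong_def power_add flip: right_diff_distrib)

lemma qcong_power_p_zero: "x \<in> Zp p \<Longrightarrow> qcong p m (of_nat p ^ m * x) 0"
  by (simp add: qcong_def)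

lemma qcong_Zp: "qcong p m x y \<Longrightarrow> y \<in> Zp p \<Longrightarrow> x \<in> Zp p"
  using qcong_mono[of m x y 0] Zp_add[of "x - y" y] by (simp add: qcong_def)

lemma qcong_of_int: "qcong p m (of_int u) (of_int v) \<longleftrightarrow> [u = v] (mod int p ^ m)"
proof
  assume "qcong p m (of_int u) (of_int v)"
  then obtain w z where wz: "\<not> int p dvd z" "z \<noteq> 0"
      "(of_int u - of_int v) / of_nat p ^ m = (of_int w / of_int z :: rat)"
    unfolding qcong_def by (metis Zp_cases)
  then have "(of_int ((u - v) * z) :: rat) = of_int (int p ^ m * w)"
    by (simp add: field_simps)
  then have "int p ^ m dvd (u - v) * z" by (simp only: of_int_eq_iff) simp
  moreover have "coprime (int p ^ m) z" using wz(1) prime_int by (simp add: prime_imp_coprime)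
  ultimately show "[u = v] (mod int p ^ m)" by (simp add: coprime_dvd_mult_left_iff cong_iff_dvd_diff)
next
  assume "[u = v] (mod int p ^ m)"
  then obtain s where "u - v = int p ^ m * s" by (auto simp: cong_iff_dvd_diff)
  then have "(of_int u - of_int v :: rat) = of_nat p ^ m * of_int s"
    by (simp flip: of_int_diff)
  then show "qcong p m (of_int u) (of_int v)" by (simp add: qcong_def)
qed

section \<open>Units of \<open>Zp p\<close>, encoded as p-integral x with
  \<open>\<not> qcong p 1 x 0\<close>, and Euler's theorem\<close>

lemma not_qcong_0_cases:
  assumes "x \<in> Zp p" "\<not> qcong p 1 x 0"
  obtains u v where "\<not> int p dvd u" "\<not> int p dvd v" "u \<noteq> 0" "v \<noteq> 0" "x = of_int u / of_int v"
proof -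
  obtain u v where uv: "\<not> int p dvd v" "v \<noteq> 0" "x = of_int u / of_int v"
    using assms(1) by (rule Zp_cases)
  then have "\<not> int p dvd u"
    using assms(2) qcong_1_of_int[OF prime_p uv(1), of u 0] by simp
  then show ?thesis using uv that by (metis dvd_0_right)
qed

lemma Zp_inverse:
  assumes "x \<in> Zp p" "\<not> qcong p 1 x 0"
  shows "x \<noteq> 0" "1 / x \<in> Zp p"
  using not_qcong_0_cases[OF assms] Zp_fraction by (metis qcong_refl assms(2),
    metis (no_types, opaque_lifting) divide_divide_eq_right mult_1)

text \<open>The exponent is the totient of p^m. Euler's theorem is applied separately to the
  numerator and the denominator, both prime to p.\<close>

lemma qcong_euler:
  assumes "x \<in> Zp p" "\<not> qcong p 1 x 0" "m > 0"
  shows "qcong p m (x ^ (p ^ (m - 1) * (p - 1))) 1"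
proof -
  obtain u v where uv: "\<not> int p dvd u" "\<not> int p dvd v" "u \<noteq> 0" "v \<noteq> 0" "x = of_int u / of_int v"
    using not_qcong_0_cases[OF assms(1,2)] .
  let ?N = "p ^ (m - 1) * (p - 1)"
  have p1: "p > 1" using prime_p by (rule prime_gt_1_nat)
  \<comment> \<open>The locale provides Euler's theorem for integer bases.\<close>
  interpret residues "int (p ^ m)" "residue_ring (int (p ^ m))"
    by unfold_locales (use p1 assms(3) in \<open>auto simp: one_less_power\<close>)
  have euler: "[w ^ ?N = 1] (mod int p ^ m)" if "\<not> int p dvd w" for w
  proof -
    have "coprime w (int (p ^ m))"
      using that prime_int by (simp add: prime_imp_coprime coprime_commute[of w])
    then show ?thesis using euler_theorem[of w] totient_prime_power[OF prime_p assms(3)]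
      by (simp add: nat_power_eq)
  qed
  have "qcong p m (of_int (u ^ ?N)) (of_int (v ^ ?N))"
    unfolding qcong_of_int using euler[OF uv(1)] euler[OF uv(2)] by (metis cong_sym cong_trans)
  moreover have "1 / of_int (v ^ ?N) \<in> Zp p"
    using Zp_fraction[of "v ^ ?N" 1] uv(2) prime_int prime_dvd_power[of "int p" v ?N] by auto
  ultimately have "qcong p m (1 / of_int (v ^ ?N) * of_int (u ^ ?N)) (1 / of_int (v ^ ?N) * of_int (v ^ ?N))"
    by (rule qcong_cmult)
  then show ?thesis using uv(4) by (simp add: uv(5) power_divide)
qed

lemma not_qcong_0_of_nat: "\<not> p dvd n \<Longrightarrow> \<not> qcong p 1 (of_nat n) 0"
  using qcong_of_int[of 1 "int n" 0] by (simp add: cong_0_iff)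

lemma not_qcong_0_cong:
  assumes "qcong p 1 x y" "\<not> qcong p 1 y 0" shows "\<not> qcong p 1 x 0"
  using assms qcong_trans qcong_sym by blast

lemma qcong_inverse:
  assumes "qcong p m x y" "x \<in> Zp p" "\<not> qcong p 1 x 0" "y \<in> Zp p" "\<not> qcong p 1 y 0"
  shows "qcong p m (1 / x) (1 / y)"
proof -
  have "qcong p m (1 / x * (1 / y) * y) (1 / x * (1 / y) * x)"
    using assms Zp_inverse by (intro qcong_cmult Zp_mult) (auto intro: qcong_sym)
  then show ?thesis using assms Zp_inverse(1) by simp
qed

lemma qcong_fermat_power:
  assumes "x \<in> Zp p" "\<not> qcong p 1 x 0"
  shows "qcong p 1 (x ^ (k + (p - 1) * q)) (x ^ k)"
proof -
  have "qcong p 1 ((x ^ (p - 1)) ^ q) (1 ^ q)"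
    using qcong_euler[OF assms, of 1] assms(1) by (intro qcong_power) auto
  then have "qcong p 1 (x ^ k * (x ^ (p - 1)) ^ q) (x ^ k * 1)"
    using assms(1) by (intro qcong_cmult) auto
  then show ?thesis by (simp only: power_add power_mult mult_1_right)
qed

text \<open>The binomial expansion to first order in p. For n = 0 the truncated exponent
  \<open>n - 1\<close> is harmless, as its coefficient is 0.\<close>

lemma qcong_power_minus_p:
  assumes "x \<in> Zp p"
  shows "qcong p 2 ((x - of_nat p) ^ n) (x ^ n - of_nat n * of_nat p * x ^ (n - 1))"
proof (induction n)
  case (Suc n)
  have "qcong p 2 ((x - of_nat p) * (x - of_nat p) ^ n)
      ((x - of_nat p) * (x ^ n - of_nat n * of_nat p * x ^ (n - 1)))"
    using assms Suc by (intro qcong_cmult) auto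
  also have "(x - of_nat p) * (x ^ n - of_nat n * of_nat p * x ^ (n - 1)) =
      x ^ Suc n - of_nat (Suc n) * of_nat p * x ^ n + of_nat p ^ 2 * (of_nat n * x ^ (n - 1))"
    by (cases n) (simp_all add: algebra_simps power2_eq_square)
  also have "qcong p 2 \<dots> (x ^ Suc n - of_nat (Suc n) * of_nat p * x ^ n + 0)"
    using assms by (intro qcong_add qcong_power_p_zero) auto
  finally show ?case by simp
qed simp

lemma bij_betw_add_mod:
  "bij_betw (\<lambda>i. nat ((int i + c) mod int p)) {..<p} {..<p}"
proof -
  have "inj_on (\<lambda>i. nat ((int i + c) mod int p)) {..<p}"
  proof (rule inj_onI)
    fix i j assume *: "i \<in> {..<p}" "j \<in> {..<p}" "nat ((int i + c) mod int p) = nat ((int j + c) mod int p)"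
    then have "(int i + c) mod int p = (int j + c) mod int p" by (simp add: nat_eq_iff)
    then have "[int i + c = int j + c] (mod int p)" by (simp add: cong_def)
    then have "[int i = int j] (mod int p)" by (simp add: cong_add_rcancel)
    then show "i = j" using * by (simp add: cong_int_iff cong_less_modulus_unique_nat)
  qed
  moreover have "(\<lambda>i. nat ((int i + c) mod int p)) ` {..<p} \<subseteq> {..<p}"
    by (auto simp: nat_less_iff)
  ultimately show ?thesis
    by (simp add: bij_betw_def endo_inj_surj)
qed

text \<open>The numbers i + x with i < p form a complete residue system modulo p, and i0 accounts
  for the zero class. The others meet each of 1, ..., p - 1 once. The factorial is left unevaluated,
  as it cancels later.\<close>

lemma prod_shifted_residues:
  assumes "x \<in> Zp p" "i0 < p" "qcong p 1 (of_nat i0 + x) 0"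
  shows "qcong p 1 (\<Prod>i\<in>{..<p} - {i0}. of_nat i + x) (fact (p - 1))"
proof -
  let ?g = "\<lambda>i. nat ((int i - int i0) mod int p)"
  have x: "qcong p 1 x (- of_nat i0)"
    using qcong_diff[OF assms(3) qcong_refl[of 1 "of_nat i0"]] by simp
  have g: "qcong p 1 (of_nat i + x) (of_nat (?g i))" for i
  proof -
    have "qcong p 1 (of_int (int i - int i0)) (of_int ((int i - int i0) mod int p))"
      unfolding qcong_of_int by (simp add: cong_def)
    moreover have "qcong p 1 (of_nat i + x) (of_nat i + - of_nat i0)"
      using x by (intro qcong_add) auto
    ultimately show ?thesis using qcong_trans by (auto simp: of_nat_nat)
  qed
  have bij: "bij_betw ?g {..<p} {..<p}"
    using bij_betw_add_mod[of "- int i0"] by simp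
  have "?g ` ({..<p} - {i0}) = {..<p} - {0}"
    using bij assms(2) inj_on_image_set_diff[of ?g "{..<p}" "{..<p}" "{i0}"]
    by (auto simp: bij_betw_def)
  then have "bij_betw ?g ({..<p} - {i0}) {1..p - 1}"
    using bij by (auto simp: bij_betw_def intro: inj_on_diff)
  then have "(\<Prod>i\<in>{..<p} - {i0}. of_nat (?g i)) = (\<Prod>i\<in>{1..p - 1}. of_nat i :: rat)"
    by (rule prod.reindex_bij_betw)
  also have "\<dots> = fact (p - 1)" by (simp add: fact_prod)
  finally show ?thesis
    using qcong_prod[of "{..<p} - {i0}" 1 "\<lambda>i. of_nat i + x" "\<lambda>i. of_nat (?g i)"] g assms(1)
    by (auto)
qed

end

section \<open>Bernoulli numbers modulo powers of a prime p > 3\<close>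

locale prime_gt_3 = prime_congruences +
  assumes p_gt_3: "p > 3"
begin

lemma p_ge_5: "p \<ge> 5"
proof (rule ccontr)
  assume "\<not> p \<ge> 5"
  then have "p = 2 * 2" using p_gt_3 by linarith
  then have "prime (2 * 2 :: nat)" using prime_p by (rule subst)
  then have "(2::nat) = 1 \<or> (2::nat) = 1" by (rule prime_product)
  then show False by simp
qed

lemma odd_p: "odd p"
  by (rule prime_odd_nat[OF prime_p]) (use p_gt_3 in simp)

lemma Zp_half: "1 / 2 \<in> Zp p"
  using Zp_inverse_of_nat[of 2] p_gt_3 by (simp add: nat_dvd_not_less)

lemma Zp_third: "1 / 3 \<in> Zp p"
  using Zp_inverse_of_nat[of 3] p_gt_3 by (simp add: nat_dvd_not_less)

text \<open>If p^e is the exact power of p in k + 1 and e > 0, then 4e + 1 <= 5^e <= p^e <= k + 1.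
  Hence k >= 4e >= 3 + e, so dividing by k + 1 still leaves a factor p^c for every c up to
  3.\<close>

lemma qcong_p_power_over_Suc:
  assumes "c \<le> 3" "c \<le> k"
  shows "qcong p c (of_nat p ^ k / of_nat (Suc k)) 0"
proof -
  have "Suc k \<noteq> 0" "\<not> is_unit p" using p_gt_3 by simp_all
  then obtain y where y: "Suc k = p ^ multiplicity p (Suc k) * y" "\<not> p dvd y"
    by (rule multiplicity_decompose'[of "Suc k" p])
  define e where "e = multiplicity p (Suc k)"
  have "p ^ e \<le> Suc k" using y(1) unfolding e_def by (metis dvd_triv_left dvd_imp_le zero_less_Suc)
  have "c + e \<le> k"
  proof (cases "e = 0")
    case False
    have "4 * d + 1 \<le> 5 ^ d" for d :: nat by (induction d) auto
    then have "4 * e + 1 \<le> p ^ e" using power_mono[OF p_ge_5, of e] le_trans by blast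
    then show ?thesis using \<open>p ^ e \<le> Suc k\<close> False assms(1) by linarith
  qed (use assms in simp)
  then obtain d where k: "k = c + e + d" using le_Suc_ex by blast
  have "(of_nat (Suc k) :: rat) = of_nat p ^ e * of_nat y"
    using y(1) by (metis e_def of_nat_mult of_nat_power)
  then have *: "of_nat p ^ k / of_nat (Suc k) = of_nat p ^ c * (of_nat p ^ d * (1 / of_nat y :: rat))"
    by (simp add: k power_add del: of_nat_Suc)
  show ?thesis unfolding *
    by (intro qcong_power_p_zero Zp_mult Zp_power Zp_of_nat Zp_inverse_of_nat[OF y(2)])
qed

text \<open>This is the quotient (B_{n+1}(x) - B_{n+1})/(n + 1), written as a polynomial in x so
  that no division by n + 1 remains.\<close>

definition bernoulli_integral :: "nat \<Rightarrow> rat \<Rightarrow> rat" where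
  "bernoulli_integral n x = (\<Sum>k\<le>n. of_nat (n choose k) * bernoulli (n - k) * x ^ Suc k / of_nat (Suc k))"

lemma bernpoly_eq_integral:
  "bernpoly (Suc n) x = bernoulli (Suc n) + of_nat (Suc n) * bernoulli_integral n x"
  using bernpoly_expand[of n x] by (simp add: bernoulli_integral_def del: bernoulli.simps of_nat_Suc)

lemma sum_powers_eq_integral: "(\<Sum>j<m. of_nat j ^ n) = bernoulli_integral n (of_nat m)"
proof -
  have "bernoulli_integral n 0 = 0" by (simp add: bernoulli_integral_def)
  then show ?thesis
    using bernpoly_add_nat[of n 0 m] by (simp add: bernpoly_eq_integral del: bernoulli.simps of_nat_Suc)
qed

text \<open>The weak half of the von Staudt-Clausen theorem. The integer sum of j^n over j < p is p
  B_n plus terms (p B_{n-k}) p^k/(k + 1) with binomial coefficients, which are integral by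
  induction.\<close>

lemma Zp_p_times_bernoulli: "of_nat p * bernoulli n \<in> Zp p"
proof (induction n rule: less_induct)
  case (less n)
  let ?t = "\<lambda>k. of_nat (n choose k) * bernoulli (n - k) * of_nat p ^ Suc k / of_nat (Suc k)"
  have "?t k \<in> Zp p" if "k \<in> {1..n}" for k
  proof -
    have "of_nat p ^ k / of_nat (Suc k) \<in> Zp p"
      using qcong_p_power_over_Suc[of 0 k] by (simp add: qcong_def)
    moreover have "of_nat p * bernoulli (n - k) \<in> Zp p" using less that by simp
    moreover have "?t k = of_nat (n choose k) * (of_nat p * bernoulli (n - k)) * (of_nat p ^ k / of_nat (Suc k))"
      by simp
    ultimately show ?thesis by (metis Zp_mult Zp_of_nat)
  qed
  then have "(\<Sum>k=1..n. ?t k) \<in> Zp p" by blast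
  moreover have "(\<Sum>j<p. of_nat j ^ n) \<in> Zp p" by blast
  moreover have "(\<Sum>j<p. of_nat j ^ n) = of_nat p * bernoulli n + (\<Sum>k=1..n. ?t k)"
  proof -
    have "{..n} = insert 0 {1..n}" by auto
    then show ?thesis unfolding sum_powers_eq_integral bernoulli_integral_def by simp
  qed
  ultimately show ?case
    using Zp_diff[of "\<Sum>j<p. of_nat j ^ n" "\<Sum>k=1..n. ?t k"] by simp
qed

text \<open>The k-th term contains the integral number p B_{n-k} and the factor p^k/(k + 1), so the
  terms with k >= c vanish modulo p^c.\<close>

lemma bernoulli_integral_truncate:
  assumes "c \<le> 3" "s \<in> Zp p"
  shows "qcong p c (bernoulli_integral n (of_nat p * s))
    (\<Sum>k<c. of_nat (n choose k) * bernoulli (n - k) * (of_nat p * s) ^ Suc k / of_nat (Suc k))"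
proof -
  define f where "f k = of_nat (n choose k) * bernoulli (n - k) * (of_nat p * s) ^ Suc k / of_nat (Suc k)" for k
  have tail: "qcong p c (f k) 0" if "c \<le> k" for k
  proof -
    have "of_nat (n choose k) * (of_nat p * bernoulli (n - k)) * s ^ Suc k \<in> Zp p"
      by (intro Zp_mult[OF Zp_mult[OF _ Zp_p_times_bernoulli]] Zp_power assms(2)) simp
    then have "qcong p c (of_nat (n choose k) * (of_nat p * bernoulli (n - k)) * s ^ Suc k *
        (of_nat p ^ k / of_nat (Suc k)))
       (of_nat (n choose k) * (of_nat p * bernoulli (n - k)) * s ^ Suc k * 0)"
      using that assms(1) by (intro qcong_cmult qcong_p_power_over_Suc)
    then show ?thesis by (simp add: f_def power_mult_distrib mult_ac)
  qed
  \<comment> \<open>The range is enlarged so that it can be split at c even if n < c; the added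
    terms vanish with their binomial coefficients.\<close>
  have "bernoulli_integral n (of_nat p * s) = (\<Sum>k<n + c + 1. f k)"
    unfolding bernoulli_integral_def f_def by (rule sum.mono_neutral_left) (auto simp: not_le)
  also have "{..<n + c + 1} = {..<c} \<union> {c..<n + c + 1}" by auto
  also have "sum f \<dots> = sum f {..<c} + sum f {c..<n + c + 1}"
    by (rule sum.union_disjoint) auto
  finally have *: "bernoulli_integral n (of_nat p * s) = sum f {..<c} + sum f {c..<n + c + 1}" .
  have "qcong p c (sum f {c..<n + c + 1}) (\<Sum>k\<in>{c..<n + c + 1}. 0)"
    by (rule qcong_sum) (simp add: tail)
  then have "qcong p c (sum f {..<c} + sum f {c..<n + c + 1}) (sum f {..<c} + 0)"
    by (intro qcong_add) simp_all
  then show ?thesis unfolding * by (simp add: f_def)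
qed

lemma Zp_bernoulli_odd: "odd n \<Longrightarrow> bernoulli n \<in> Zp p"
  using bernoulli_odd[of n] Zp_uminus[OF Zp_half]
  by (cases "n = 1") (auto simp: numeral_2_eq_2)

text \<open>Truncation at s = 1 leaves two terms. The second is p^2 n B_{n-1}/2 with n - 1 odd,
  hence 0 modulo p^2.\<close>

lemma sum_powers_cong_bernoulli:
  assumes "even n" "n > 0"
  shows "qcong p 2 (\<Sum>j<p. of_nat j ^ n) (of_nat p * bernoulli n)"
proof -
  have "qcong p 2 (\<Sum>j<p. of_nat j ^ n) (of_nat p * bernoulli n +
     of_nat p ^ 2 * (1 / 2 * (of_nat n * bernoulli (n - 1))))"
    using bernoulli_integral_truncate[of 2 1 n]
    by (simp add: sum_powers_eq_integral numeral_2_eq_2 mult_ac)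
  also have "qcong p 2 \<dots> (of_nat p * bernoulli n + 0)"
    using assms Zp_half Zp_bernoulli_odd by (intro qcong_add qcong_power_p_zero Zp_mult) auto
  finally show ?thesis by simp
qed

section \<open>Doubling the residues, and Kummer's congruence\<close>

lemma not_qcong_0_numeral2: "\<not> qcong p 1 2 0"
  using not_qcong_0_of_nat[of 2] p_gt_3 by (simp add: nat_dvd_not_less)

text \<open>The sum runs over the residues whose double must be reduced by p; it measures the
  first-order effect of that reduction on a power sum.\<close>

definition doubling_carry :: "nat \<Rightarrow> rat" where
  "doubling_carry n = (\<Sum>j | j < p \<and> p \<le> 2 * j. of_nat (2 * j) ^ n)"

text \<open>As p is odd, j -> 2j mod p permutes the residues. The reduced value is 2j or 2j - p, and
  in the second case the power is expanded to first order in p.\<close>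

lemma sum_powers_double:
  "qcong p 2 ((2 ^ m - 1) * (\<Sum>j<p. of_nat j ^ m)) (of_nat m * of_nat p * doubling_carry (m - 1))"
proof -
  let ?T = "\<Sum>j<p. of_nat j ^ m :: rat"
  have "bij_betw (\<lambda>j. (2 * j) mod p) {..<p} {..<p}"
  proof -
    have "inj_on (\<lambda>j. (2 * j) mod p) {..<p}"
    proof (rule inj_onI)
      fix i j assume *: "i \<in> {..<p}" "j \<in> {..<p}" "2 * i mod p = 2 * j mod p"
      then have "[2 * i = 2 * j] (mod p)" by (simp add: cong_def)
      moreover have "coprime 2 p" using odd_p by (simp add: coprime_left_2_iff_odd)
      ultimately have "[i = j] (mod p)" using cong_mult_lcancel_nat by blast
      then show "i = j" using * by (simp add: cong_less_modulus_unique_nat)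
    qed
    moreover have "(\<lambda>j. (2 * j) mod p) ` {..<p} \<subseteq> {..<p}" by auto
    ultimately show ?thesis by (simp add: bij_betw_def endo_inj_surj)
  qed
  then have "?T = (\<Sum>j<p. of_nat (2 * j mod p) ^ m)"
    by (rule sum.reindex_bij_betw[symmetric])
  also have "qcong p 2 \<dots>
      (\<Sum>j<p. of_nat (2 * j) ^ m - (if p \<le> 2 * j then of_nat m * of_nat p * of_nat (2 * j) ^ (m - 1) else 0))"
  proof (rule qcong_sum)
    fix j assume "j \<in> {..<p}"
    show "qcong p 2 (of_nat (2 * j mod p) ^ m)
      (of_nat (2 * j) ^ m - (if p \<le> 2 * j then of_nat m * of_nat p * of_nat (2 * j) ^ (m - 1) else 0))"
    proof (cases "p \<le> 2 * j")
      case True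
      then have "2 * j mod p = 2 * j - p" using \<open>j \<in> {..<p}\<close>
        by (simp add: mod_if)
      then have *: "(of_nat (2 * j mod p) :: rat) = of_nat (2 * j) - of_nat p"
        using True by (simp only: of_nat_diff)
      show ?thesis unfolding * using True qcong_power_minus_p[OF Zp_of_nat, of "2 * j" m] by simp
    qed simp
  qed
  also have "(\<Sum>j<p. of_nat (2 * j) ^ m - (if p \<le> 2 * j then of_nat m * of_nat p * of_nat (2 * j) ^ (m - 1) else 0))
      = 2 ^ m * ?T - of_nat m * of_nat p * doubling_carry (m - 1)"
  proof -
    have "(\<Sum>j<p. if p \<le> 2 * j then of_nat m * of_nat p * of_nat (2 * j) ^ (m - 1) else 0 :: rat)
        = of_nat m * of_nat p * doubling_carry (m - 1)"
      unfolding doubling_carry_def sum_distrib_left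
      by (rule sum.mono_neutral_cong_right) auto
    then show ?thesis
      by (simp add: sum_subtractf sum_distrib_left power_mult_distrib)
  qed
  finally have "qcong p 2 (2 ^ m * ?T - ?T) (2 ^ m * ?T - (2 ^ m * ?T - of_nat m * of_nat p * doubling_carry (m - 1)))"
    by (intro qcong_diff) auto
  then show ?thesis by (simp add: algebra_simps)
qed

lemma Zp_doubling_carry: "doubling_carry n \<in> Zp p"
  unfolding doubling_carry_def by blast

lemma doubling_carry_period:
  "qcong p 1 (doubling_carry (n + (p - 1) * q)) (doubling_carry n)"
  unfolding doubling_carry_def
proof (intro qcong_sum qcong_fermat_power Zp_of_nat not_qcong_0_of_nat)
  fix j assume "j \<in> {j. j < p \<and> p \<le> 2 * j}"
  then show "\<not> p dvd 2 * j"
    using odd_p prime_p p_gt_3 prime_dvd_mult_iff[of p 2 j] by (auto simp: nat_dvd_not_less)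
qed

text \<open>
  Multiplying the residues by 2 determines the power sum of exponent \<open>m\<close> modulo \<open>p\<^sup>2\<close> up to
  the factor \<open>2 ^ m - 1\<close>, which for \<open>m \<equiv> - 2\<close> modulo \<open>p - 1\<close> is congruent to \<open>- 3 / 4\<close>.
\<close>
lemma sum_powers_minus_two:
  assumes m: "m = p - 3 + (p - 1) * q"
  shows "qcong p 2 (3 * (\<Sum>j<p. of_nat j ^ m)) (4 * (of_nat q + 3) * of_nat p * doubling_carry (p - 4))"
proof -
  define T where "T = (\<Sum>j<p. of_nat j ^ m :: rat)"
  define V where "V = doubling_carry (p - 4)"
  have VZ: "V \<in> Zp p" and TZ: "T \<in> Zp p"
    unfolding V_def T_def using Zp_doubling_carry by blast+
  have "qcong p 1 (2 ^ (p - 3 + (p - 1) * q)) (2 ^ (p - 3))"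
    by (rule qcong_fermat_power[OF Zp_numeral not_qcong_0_numeral2])
  then have "qcong p 1 (4 * 2 ^ m) (4 * 2 ^ (p - 3))"
    unfolding m by (rule qcong_cmult) simp
  also have "4 * 2 ^ (p - 3) = (2 ^ (p - 1) :: rat)"
  proof -
    have "p - 1 = p - 3 + 2" using p_gt_3 by simp
    then show ?thesis by (simp only: power_add) simp
  qed
  also have "qcong p 1 (2 ^ (p - 1)) 1"
    using qcong_euler[OF Zp_numeral not_qcong_0_numeral2, of 1] by simp
  finally have "qcong p 1 (4 * 2 ^ m - 1) (1 - 1)" by (rule qcong_diff) simp
  moreover define e :: rat where "e = (4 * 2 ^ m - 1) / of_nat p"
  ultimately have e: "4 * 2 ^ m - 1 = of_nat p * e" "e \<in> Zp p"
    by (simp_all add: qcong_def)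
  have carry: "qcong p 1 (doubling_carry (m - 1)) V"
    using doubling_carry_period[of "p - 4" q] p_gt_3 by (simp add: V_def m)
  \<comment> \<open>The reason is m + q + 3 = p(1 + q).\<close>
  have m_cong: "qcong p 1 (of_nat m) (- (of_nat q + 3))"
  proof -
    obtain d where "p = d + 3" using p_gt_3 by (metis add.commute le_Suc_ex less_imp_le)
    then have "of_nat (m + (q + 3)) = (of_nat (p * (1 + q)) :: rat)"
      by (simp add: m algebra_simps)
    then have "of_nat m - (- (of_nat q + 3)) = (of_nat p * (1 + of_nat q) :: rat)"
      by (simp add: algebra_simps)
    then show ?thesis by (simp add: qcong_def) (metis Zp_1 Zp_add Zp_of_nat)
  qed
  \<comment> \<open>The factor 4 makes 4(2^m - 1) equal to pe - 3.\<close>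
  have "qcong p 2 (4 * ((2 ^ m - 1) * T)) (4 * (of_nat m * of_nat p * doubling_carry (m - 1)))"
    unfolding T_def by (rule qcong_cmult[OF sum_powers_double]) simp
  also have "4 * (of_nat m * of_nat p * doubling_carry (m - 1)) =
      of_nat p ^ 1 * (4 * (of_nat m * doubling_carry (m - 1)))" by simp
  also have "qcong p 2 \<dots> (of_nat p ^ 1 * (4 * (- (of_nat q + 3) * V)))"
    unfolding qcong_shift[of 1 1, unfolded one_add_one] using VZ by (intro qcong_cmult qcong_mult m_cong carry) auto
  also have "4 * ((2 ^ m - 1) * T) = (4 * 2 ^ m - 1) * T - 3 * T" by (simp add: algebra_simps)
  finally have main: "qcong p 2 (of_nat p * e * T - 3 * T) (of_nat p * (4 * (- (of_nat q + 3) * V)))"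
    by (simp add: e numeral_2_eq_2)
  \<comment> \<open>The congruence is first read modulo p, which gives p | T. Then p e T is 0 modulo
    p^2 and drops out.\<close>
  have "qcong p 1 (of_nat p * e * T - (of_nat p * e * T - 3 * T)) (of_nat p ^ 1 * (e * T) - of_nat p * (4 * (- (of_nat q + 3) * V)))"
    by (intro qcong_diff qcong_mono[OF main]) (simp_all add: mult.assoc)
  also have "of_nat p ^ 1 * (e * T) - of_nat p * (4 * (- (of_nat q + 3) * V))
       = of_nat p ^ 1 * (e * T - 4 * (- (of_nat q + 3) * V))" by (simp add: algebra_simps)
  also have "qcong p 1 \<dots> 0"
    using e VZ TZ by (intro qcong_power_p_zero Zp_diff Zp_mult Zp_uminus Zp_add) auto
  finally have "qcong p 1 (1 / 3 * (3 * T)) (1 / 3 * 0)"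
    by (intro qcong_cmult Zp_third) simp
  moreover define T' where "T' = T / of_nat p"
  ultimately have T': "T = of_nat p * T'" "T' \<in> Zp p"
    by (simp_all add: qcong_def)
  have "qcong p 2 (of_nat p * e * T) 0"
    using T' e by (auto simp: qcong_def power2_eq_square)
  then have "qcong p 2 (of_nat p * e * T - (of_nat p * e * T - 3 * T)) (0 - of_nat p * (4 * (- (of_nat q + 3) * V)))"
    using main by (rule qcong_diff)
  then show ?thesis by (simp add: T_def V_def algebra_simps)
qed

text \<open>The totient of p^3, so that x^N is 1 modulo p^3 for every unit x.\<close>

abbreviation N :: nat where "N \<equiv> p ^ 2 * (p - 1)"

text \<open>Both N - 2 and p - 3 have the form p - 3 + (p - 1)q, with q = p^2 - 1 and q = 0. The
  crude lower bound serves to control truncated subtraction.\<close>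

lemma N_eq: "N - 2 = p - 3 + (p - 1) * (p ^ 2 - 1)"
  and N_large: "N \<ge> 100" and even_N: "even N"
proof -
  define X where "X = N"
  have "1 * (p - 1) \<le> X" unfolding X_def by (rule mult_le_mono1) (simp add: Suc_leI)
  moreover have "(p - 1) * (p ^ 2 - 1) = X - (p - 1)"
    unfolding X_def by (simp add: algebra_simps diff_mult_distrib2)
  ultimately have "X - 2 = p - 3 + (p - 1) * (p ^ 2 - 1)"
    using p_gt_3 by linarith
  then show "N - 2 = p - 3 + (p - 1) * (p ^ 2 - 1)" by (simp only: X_def)
  have "5 ^ 2 * (5 - 1) \<le> N" using p_ge_5 by (intro mult_le_mono power_mono diff_le_mono) auto
  then show "N \<ge> 100" by simp
  show "even N" using odd_p by simp
qed

text \<open>With q = p^2 - 1 and q = 0 the factor q + 3 in \<open>sum_powers_minus_two\<close>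
  becomes p^2 + 2 and 3. So the two power sums are in the ratio 2 : 3 modulo p^2, and they are p
  B_{N-2} and p B_{p-3} there.\<close>

lemma bernoulli_kummer: "qcong p 1 (3 * bernoulli (N - 2)) (2 * bernoulli (p - 3))"
proof -
  let ?T = "\<lambda>m. \<Sum>j<p. of_nat j ^ m :: rat" and ?V = "doubling_carry (p - 4)"
  have "qcong p 2 (3 * (3 * ?T (N - 2))) (3 * (4 * (of_nat (p ^ 2 - 1) + 3) * of_nat p * ?V))"
    by (intro qcong_cmult sum_powers_minus_two N_eq) simp
  also have "3 * (4 * (of_nat (p ^ 2 - 1) + 3) * of_nat p * ?V) =
      of_nat p ^ 2 * (12 * (of_nat p * ?V)) + 2 * (4 * (of_nat 0 + 3) * of_nat p * ?V)"
    by (simp add: of_nat_diff algebra_simps Suc_leI)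
  also have "qcong p 2 \<dots> (0 + 2 * (3 * ?T (p - 3)))"
    using Zp_doubling_carry
    by (intro qcong_add qcong_power_p_zero qcong_cmult qcong_sym[OF sum_powers_minus_two]) auto
  finally have "qcong p 2 (1 / 3 * (3 * (3 * ?T (N - 2)))) (1 / 3 * (0 + 2 * (3 * ?T (p - 3))))"
    by (intro qcong_cmult Zp_third)
  then have T: "qcong p 2 (3 * ?T (N - 2)) (2 * ?T (p - 3))" by simp
  have "qcong p 2 (3 * (of_nat p * bernoulli (N - 2))) (3 * ?T (N - 2))"
    using N_large even_N by (intro qcong_cmult qcong_sym[OF sum_powers_cong_bernoulli]) auto
  also note T
  also have "qcong p 2 (2 * ?T (p - 3)) (2 * (of_nat p * bernoulli (p - 3)))"
    using odd_p p_gt_3 by (intro qcong_cmult sum_powers_cong_bernoulli) auto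
  finally have "qcong p (1 + 1) (of_nat p ^ 1 * (3 * bernoulli (N - 2))) (of_nat p ^ 1 * (2 * bernoulli (p - 3)))"
    by (simp add: numeral_2_eq_2 algebra_simps)
  then show ?thesis unfolding qcong_shift .
qed

end

section \<open>The binomial sum\<close>

definition gbinom_pair :: "nat \<Rightarrow> rat \<Rightarrow> rat" where
  "gbinom_pair k a = (a gchoose k) * ((- 1 - a) gchoose k)"

text \<open>A partial product of Euler's product for sin(pi x)/(pi x).\<close>

definition wallis_prod :: "nat \<Rightarrow> rat \<Rightarrow> rat" where
  "wallis_prod n x = (\<Prod>i=1..n. 1 - x ^ 2 / of_nat i ^ 2)"

lemma wallis_prod_Suc:
  "wallis_prod (Suc n) x = wallis_prod n x * (1 - x ^ 2 / of_nat (Suc n) ^ 2)"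
  by (simp add: wallis_prod_def mult.commute)

lemma gbinom_pair_Suc:
  "gbinom_pair (Suc k) a = gbinom_pair k a * ((a - of_nat k) * (- 1 - a - of_nat k)) / of_nat (Suc k) ^ 2"
proof -
  have "x gchoose Suc k = (x gchoose k) * (x - of_nat k) / of_nat (Suc k)" for x :: rat
    using gbinomial_absorb_comp[of x k] gbinomial_absorption[of k x]
    by (simp add: gbinomial_prod_rev field_simps del: of_nat_Suc)
  then show ?thesis by (simp add: gbinom_pair_def power2_eq_square del: of_nat_Suc)
qed

text \<open>The numerator is the product of (i - a)(i + 1 + a) for i = 0, ..., k. Pairing i - a with
  i + a gives i^2 - a^2 and leaves over -a and a + k + 1.\<close>

lemma gbinom_pair_eq_wallis_prod:
  "gbinom_pair (Suc k) a = - a * (a + of_nat (Suc k)) / of_nat (Suc k) ^ 2 * wallis_prod k a"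
proof (induction k)
  case 0
  then show ?case by (simp add: gbinom_pair_def wallis_prod_def algebra_simps)
next
  case (Suc k)
  define m :: rat where "m = of_nat (Suc k)"
  have nz: "m \<noteq> 0" by (simp add: m_def del: of_nat_Suc)
  have W: "wallis_prod (Suc k) a * m ^ 2 = wallis_prod k a * ((m - a) * (m + a))"
    using nz unfolding wallis_prod_Suc m_def[symmetric] by (simp add: power2_eq_square field_simps)
  have "gbinom_pair (Suc (Suc k)) a * (m + 1) ^ 2 * m ^ 2
     = gbinom_pair (Suc k) a * m ^ 2 * ((a - m) * (- 1 - a - m))"
    using nz by (simp add: gbinom_pair_Suc[of "Suc k"] m_def)
  also have "gbinom_pair (Suc k) a * m ^ 2 = - a * (a + m) * wallis_prod k a"
    using nz unfolding Suc.IH m_def[symmetric] by simp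
  also have "- a * (a + m) * wallis_prod k a * ((a - m) * (- 1 - a - m))
     = - a * (a + (m + 1)) * (wallis_prod k a * ((m - a) * (m + a)))"
    by (simp add: algebra_simps)
  also have "\<dots> = - a * (a + (m + 1)) * wallis_prod (Suc k) a * m ^ 2"
    by (simp add: W flip: mult.assoc)
  finally have "gbinom_pair (Suc (Suc k)) a * (m + 1) ^ 2 = - a * (a + (m + 1)) * wallis_prod (Suc k) a"
    by (subst (asm) mult_right_cancel) (use nz in simp)
  moreover have "of_nat (Suc (Suc k)) = m + 1" "m + 1 \<noteq> 0"
    by (simp_all add: m_def)
  ultimately show ?case by (simp only:) (simp add: field_simps)
qed

lemma gbinom_pair_reflect: "gbinom_pair k (- 1 - a) = gbinom_pair k a"
  by (simp add: gbinom_pair_def mult.commute)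

text \<open>By reflection the pair at a - 1 equals the pair at -a, and \<open>wallis_prod\<close> is
  even. The k-th difference is therefore -2a/k^2 times the product up to k - 1, which is a
  difference of consecutive products times 2/a.\<close>

lemma sum_gbinom_pair_diff:
  assumes "a \<noteq> 0"
  shows "(\<Sum>k=1..n. 1 / of_nat k * gbinom_pair k a) - (\<Sum>k=1..n. 1 / of_nat k * gbinom_pair k (a - 1))
    = 2 / a * (wallis_prod n a - 1)"
proof (induction n)
  case 0
  then show ?case by (simp add: wallis_prod_def)
next
  case (Suc n)
  define m :: rat where "m = of_nat (Suc n)"
  have nz: "m \<noteq> 0" by (simp add: m_def del: of_nat_Suc)
  have "gbinom_pair (Suc n) (a - 1) = gbinom_pair (Suc n) (- a)"
    using gbinom_pair_reflect[of "Suc n" "- a"] by simp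
  also have "\<dots> = a * (m - a) / m ^ 2 * wallis_prod n a"
    unfolding gbinom_pair_eq_wallis_prod by (simp add: wallis_prod_def m_def)
  finally have reflected: "gbinom_pair (Suc n) (a - 1) = a * (m - a) / m ^ 2 * wallis_prod n a" .
  have "1 / m * gbinom_pair (Suc n) a - 1 / m * gbinom_pair (Suc n) (a - 1)
      = - 2 * a / m ^ 2 * wallis_prod n a"
    using nz unfolding reflected unfolding gbinom_pair_eq_wallis_prod m_def[symmetric]
    by (simp add: field_simps power2_eq_square)
  moreover have "2 / a * (wallis_prod (Suc n) a - 1) - 2 / a * (wallis_prod n a - 1) = - 2 * a / m ^ 2 * wallis_prod n a"
    using nz assms unfolding wallis_prod_Suc m_def[symmetric] by (simp add: field_simps power2_eq_square)
  ultimately show ?case using Suc.IH by (simp add: algebra_simps flip: m_def del: of_nat_Suc)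
qed

section \<open>Wallis products and harmonic sums modulo powers of p\<close>

context prime_gt_3 begin

lemma not_p_dvd: "0 < k \<Longrightarrow> k < p \<Longrightarrow> \<not> p dvd k"
  by (simp add: nat_dvd_not_less)

lemma qcong_wallis_prod_multiple:
  assumes "s \<in> Zp p" "n < p"
  shows "qcong p 2 (wallis_prod n (of_nat p * s)) 1"
proof -
  have "qcong p 2 (1 - (of_nat p * s) ^ 2 / of_nat i ^ 2) 1" if "i \<in> {1..n}" for i
  proof -
    have i: "1 / of_nat i \<in> Zp p" using that assms by (intro Zp_inverse_of_nat not_p_dvd) auto
    have "qcong p 2 (1 - of_nat p ^ 2 * (s * (1 / of_nat i)) ^ 2) (1 - 0)"
      by (intro qcong_diff qcong_power_p_zero qcong_refl Zp_power Zp_mult assms i)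
    then show ?thesis by (simp add: power_mult_distrib power_divide)
  qed
  then have "qcong p 2 (wallis_prod n (of_nat p * s)) (\<Prod>i=1..n. 1)"
    unfolding wallis_prod_def by (intro qcong_prod) (auto intro: qcong_Zp)
  then show ?thesis by simp
qed

lemma not_qcong_0_fact: "n < p \<Longrightarrow> \<not> qcong p 1 (fact n) 0"
  using not_qcong_0_of_nat[of "fact n"] prime_p by (simp add: prime_dvd_fact_iff)

text \<open>
  Exactly two of the linear factors \<open>i \<plusminus> x\<close> are divisible by \<open>p\<close>; the remaining ones run through
  the non-zero residues.
\<close>
lemma qcong_wallis_prod_unit:
  assumes s: "s \<in> Zp p" and j: "0 < j" "j < p" and x: "x = of_nat p * s + of_nat j"
  shows "qcong p 3 (wallis_prod (p - 1) x) (of_nat p ^ 2 * (s * (s + 1)) / x ^ 2)"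
proof -
  let ?f = "fact (p - 1) :: rat"
  define Q where "Q y i0 = (\<Prod>i\<in>{..<p} - {i0}. of_nat i + y)" for y :: rat and i0 :: nat
  have xZ: "x \<in> Zp p" using s by (auto simp: x)
  \<comment> \<open>Adding the index 0 completes the residue system at the cost of a factor y; the
    factor at i0 is then taken out.\<close>
  have split: "(\<Prod>i=1..p - 1. of_nat i + y) = (of_nat i0 + y) * Q y i0 / y"
    if "i0 < p" "y \<noteq> 0" for y :: rat and i0
  proof -
    have "(\<Prod>i<p. of_nat i + y) = (of_nat i0 + y) * Q y i0"
      unfolding Q_def using that by (intro prod.remove) auto
    moreover have "{..<p} = insert 0 {1..p - 1}" using p_gt_3 by auto
    ultimately show ?thesis using that by (simp add: field_simps)
  qed
  have xj: "qcong p 1 x (of_nat j)"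
    using qcong_add[OF qcong_power_p_zero[OF s, of 1] qcong_refl[of 1 "of_nat j"]] by (simp add: x)
  have x_unit: "\<not> qcong p 1 x 0"
    using not_qcong_0_cong[OF xj] not_qcong_0_of_nat[OF not_p_dvd[OF j]] by blast
  have xinv: "x \<noteq> 0" "1 / x \<in> Zp p" using Zp_inverse[OF xZ x_unit] .
  have fZ: "?f \<in> Zp p" using Zp_of_nat[of "fact (p - 1)"] by simp
  have finv: "?f \<noteq> 0" "1 / ?f \<in> Zp p"
    using Zp_inverse[of ?f] not_qcong_0_fact[of "p - 1"] Zp_of_nat[of "fact (p - 1)"] by auto
  have QZ: "Q y i0 \<in> Zp p" if "y \<in> Zp p" for y i0
    unfolding Q_def using that by blast
  have "wallis_prod (p - 1) x = (\<Prod>i=1..p - 1. (of_nat i + - x) * (of_nat i + x) / of_nat i ^ 2)"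
    unfolding wallis_prod_def by (intro prod.cong) (auto simp: field_simps power2_eq_square)
  also have "\<dots> = (\<Prod>i=1..p - 1. of_nat i + - x) * (\<Prod>i=1..p - 1. of_nat i + x) / ?f ^ 2"
    by (simp add: prod_dividef prod.distrib prod_power_distrib fact_prod)
  \<comment> \<open>The multiples of p are i - x at i = j, equal to -ps, and i + x at i = p - j,
    equal to p(s + 1). The sign of -s cancels against that of -x.\<close>
  also have "\<dots> = ((of_nat j + - x) * Q (- x) j / (- x)) * ((of_nat (p - j) + x) * Q x (p - j) / x) / ?f ^ 2"
    using split[of j "- x"] split[of "p - j" x] j xinv by (simp only:) simp
  also have "of_nat j + - x = of_nat p * (- s)" by (simp add: x)
  also have "of_nat (p - j) + x = of_nat p * (s + 1)" using j by (simp add: x of_nat_diff algebra_simps)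
  finally have W: "wallis_prod (p - 1) x = of_nat p ^ 2 * (s * (s + 1) * (1 / x) ^ 2 * (Q (- x) j * Q x (p - j) * (1 / ?f) ^ 2))"
    using xinv by (simp add: power2_eq_square)
  have "qcong p 1 (Q (- x) j) ?f"
    unfolding Q_def using j xZ s
    by (intro prod_shifted_residues) (auto simp: x intro: qcong_power_p_zero[of "- s" 1, simplified])
  moreover have "qcong p 1 (Q x (p - j)) ?f"
    unfolding Q_def using j xZ s qcong_power_p_zero[of "s + 1" 1]
    by (intro prod_shifted_residues) (auto simp: x of_nat_diff algebra_simps)
  ultimately have "qcong p 1 (Q (- x) j * Q x (p - j) * (1 / ?f) ^ 2) (?f * ?f * (1 / ?f) ^ 2)"
    by (intro qcong_mult qcong_refl Zp_mult Zp_power QZ Zp_uminus xZ finv fZ)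
  also have "?f * ?f * (1 / ?f) ^ 2 = 1" using finv by (simp add: power2_eq_square)
  finally have "qcong p 1 (s * (s + 1) * (1 / x) ^ 2 * (Q (- x) j * Q x (p - j) * (1 / ?f) ^ 2)) (s * (s + 1) * (1 / x) ^ 2 * 1)"
    using s xinv by (intro qcong_cmult) auto
  then have "qcong p (2 + 1) (wallis_prod (p - 1) x) (of_nat p ^ 2 * (s * (s + 1) * (1 / x) ^ 2 * 1))"
    unfolding W qcong_shift .
  then show ?thesis by (simp add: power_divide numeral_3_eq_3)
qed

text \<open>It exchanges the inverse powers in the sum for the positive powers produced by Bernoulli
  polynomials.\<close>

lemma qcong_power_N_minus:
  assumes "x \<in> Zp p" "\<not> qcong p 1 x 0" "i \<le> 3"
  shows "qcong p 3 (x ^ (N - i)) (1 / x ^ i)"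
proof -
  have "qcong p 3 (1 / x ^ i * x ^ N) (1 / x ^ i * 1)"
    using qcong_euler[OF assms(1,2), of 3] Zp_power[OF Zp_inverse(2)[OF assms(1,2)], of i]
    by (intro qcong_cmult) (simp_all add: power_divide)
  moreover have "x ^ N = x ^ i * x ^ (N - i)"
    using N_large assms(3) by (simp flip: power_add)
  ultimately show ?thesis using Zp_inverse(1)[OF assms(1,2)] by simp
qed

lemma of_nat_unit:
  assumes "k \<in> {1..p - 1}" shows "\<not> qcong p 1 (of_nat k) 0" "1 / of_nat k \<in> Zp p"
proof -
  have "\<not> p dvd k" using assms by (intro not_p_dvd) auto
  then show "\<not> qcong p 1 (of_nat k) 0" "1 / of_nat k \<in> Zp p"
    by (rule not_qcong_0_of_nat, rule Zp_inverse_of_nat)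
qed

lemma sum_inverse_squares:
  "qcong p 2 (\<Sum>k=1..p - 1. 1 / of_nat k ^ 2) (of_nat p * bernoulli (N - 2))"
proof -
  have "qcong p 2 (\<Sum>k=1..p - 1. 1 / of_nat k ^ 2) (\<Sum>k=1..p - 1. of_nat k ^ (N - 2))"
    by (intro qcong_sum qcong_sym[OF qcong_mono[OF qcong_power_N_minus]] of_nat_unit) simp_all
  also have "(\<Sum>k=1..p - 1. of_nat k ^ (N - 2)) = (\<Sum>k<p. of_nat k ^ (N - 2) :: rat)"
    using N_large by (intro sum.mono_neutral_left) (auto simp: not_le)
  also have "qcong p 2 \<dots> (of_nat p * bernoulli (N - 2))"
    using N_large even_N by (intro sum_powers_cong_bernoulli) auto
  finally show ?thesis .
qed

text \<open>Pairing k with p - k shows that the sum is congruent to its own negative, and 2 is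
  invertible.\<close>

lemma sum_inverse_cubes: "qcong p 1 (\<Sum>k=1..p - 1. 1 / of_nat k ^ 3) 0"
proof -
  let ?H = "\<Sum>k=1..p - 1. 1 / of_nat k ^ 3 :: rat"
  have "?H = (\<Sum>k=1..p - 1. 1 / of_nat (p - k) ^ 3)"
    by (rule sum.reindex_bij_witness[of _ "\<lambda>k. p - k" "\<lambda>k. p - k"]) auto
  also have "qcong p 1 \<dots> (\<Sum>k=1..p - 1. - (1 / of_nat k ^ 3))"
  proof (rule qcong_sum)
    fix k assume k: "k \<in> {1..p - 1}"
    then have pk: "p - k \<in> {1..p - 1}" and "k \<le> p" by auto
    have "qcong p 1 (of_nat p ^ 1 * 1 - of_nat k) (0 - of_nat k)"
      by (intro qcong_diff qcong_power_p_zero) auto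
    then have "qcong p 1 (of_nat (p - k)) (- of_nat k)"
      using \<open>k \<le> p\<close> by (simp add: of_nat_diff)
    moreover have "\<not> qcong p 1 (- of_nat k) 0"
      using of_nat_unit(1)[OF k] qcong_uminus[of 1 "- of_nat k" 0] by auto
    ultimately have "qcong p 1 (1 / of_nat (p - k)) (1 / (- of_nat k))"
      using of_nat_unit[OF pk] by (intro qcong_inverse) auto
    then have "qcong p 1 ((1 / of_nat (p - k)) ^ 3) ((1 / (- of_nat k)) ^ 3)"
      using of_nat_unit(2)[OF pk] Zp_uminus[OF of_nat_unit(2)[OF k]] by (intro qcong_power) auto
    then show "qcong p 1 (1 / of_nat (p - k) ^ 3) (- (1 / of_nat k ^ 3))"
      by (simp add: power_divide)
  qed
  finally have "qcong p 1 (?H + ?H) (- ?H + ?H)"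
    by (intro qcong_add) (auto simp: sum_negf)
  then have "qcong p 1 (1 / 2 * (?H + ?H)) (1 / 2 * (- ?H + ?H))"
    by (intro qcong_cmult Zp_half)
  then show ?thesis by simp
qed

section \<open>The binomial sum modulo p^3\<close>

definition binomial_sum :: "rat \<Rightarrow> rat" where
  "binomial_sum a = (\<Sum>k=1..p - 1. 1 / of_nat k * gbinom_pair k a)"

text \<open>Each term has the factor ps, so its Wallis product is needed only modulo p^2, where it
  is 1. What remains is -ps/k^2 - p^2 s^2/k^3; the squares sum to p B_{N-2} modulo p^2 and the cubes
  to 0 modulo p.\<close>

lemma binomial_sum_multiple:
  assumes s: "s \<in> Zp p"
  shows "qcong p 3 (binomial_sum (of_nat p * s)) (- (of_nat p ^ 2 * s * bernoulli (N - 2)))"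
proof -
  let ?x = "of_nat p * s"
  have "qcong p 3 (1 / of_nat k * gbinom_pair k ?x)
      (of_nat p * (- s * (1 / of_nat k ^ 2)) + of_nat p ^ 2 * (- (s ^ 2) * (1 / of_nat k ^ 3)))" if k: "k \<in> {1..p - 1}" for k
  proof -
    have inv: "1 / of_nat k \<in> Zp p" by (rule of_nat_unit(2)[OF k])
    obtain l where l: "k = Suc l" "l < p" using k by (cases k) auto
    have "qcong p (1 + 2) (of_nat p ^ 1 * (- s * (?x + of_nat k) * (1 / of_nat k) ^ 3 * wallis_prod l ?x))
       (of_nat p ^ 1 * (- s * (?x + of_nat k) * (1 / of_nat k) ^ 3 * 1))"
      unfolding qcong_shift
      by (intro qcong_cmult qcong_wallis_prod_multiple l Zp_mult Zp_add Zp_uminus Zp_power s inv Zp_of_nat)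
    moreover have "of_nat p ^ 1 * (- s * (?x + of_nat k) * (1 / of_nat k) ^ 3 * wallis_prod l ?x) = 1 / of_nat k * gbinom_pair k ?x"
      unfolding l(1) gbinom_pair_eq_wallis_prod by (simp add: power_divide power2_eq_square power3_eq_cube mult_ac del: of_nat_Suc)
    moreover have "of_nat p ^ 1 * (- s * (?x + of_nat k) * (1 / of_nat k) ^ 3 * 1) =
        of_nat p * (- s * (1 / of_nat k ^ 2)) + of_nat p ^ 2 * (- (s ^ 2) * (1 / of_nat k ^ 3))"
      using k by (simp add: field_simps power2_eq_square power3_eq_cube)
    ultimately show ?thesis by (simp add: numeral_3_eq_3)
  qed
  then have "qcong p 3 (binomial_sum ?x) (\<Sum>k=1..p - 1. of_nat p * (- s * (1 / of_nat k ^ 2)) + of_nat p ^ 2 * (- (s ^ 2) * (1 / of_nat k ^ 3)))"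
    unfolding binomial_sum_def by (rule qcong_sum)
  also have "(\<Sum>k=1..p - 1. of_nat p * (- s * (1 / of_nat k ^ 2)) + of_nat p ^ 2 * (- (s ^ 2) * (1 / of_nat k ^ 3)))
     = of_nat p ^ 1 * (- s * (\<Sum>k=1..p - 1. 1 / of_nat k ^ 2)) + of_nat p ^ 2 * (- (s ^ 2) * (\<Sum>k=1..p - 1. 1 / of_nat k ^ 3))"
    by (simp only: sum.distrib sum_distrib_left power_one_right)
  also have "qcong p 3 \<dots> (of_nat p ^ 1 * (- s * (of_nat p * bernoulli (N - 2))) + of_nat p ^ 2 * (- (s ^ 2) * 0))"
  proof (rule qcong_add)
    have "qcong p (1 + 2) (of_nat p ^ 1 * (- s * (\<Sum>k=1..p - 1. 1 / of_nat k ^ 2))) (of_nat p ^ 1 * (- s * (of_nat p * bernoulli (N - 2))))"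
      unfolding qcong_shift by (intro qcong_cmult sum_inverse_squares Zp_uminus s)
    then show "qcong p 3 (of_nat p ^ 1 * (- s * (\<Sum>k=1..p - 1. 1 / of_nat k ^ 2))) (of_nat p ^ 1 * (- s * (of_nat p * bernoulli (N - 2))))"
      by (simp add: numeral_3_eq_3)
    have "qcong p (2 + 1) (of_nat p ^ 2 * (- (s ^ 2) * (\<Sum>k=1..p - 1. 1 / of_nat k ^ 3))) (of_nat p ^ 2 * (- (s ^ 2) * 0))"
      unfolding qcong_shift by (intro qcong_cmult sum_inverse_cubes Zp_uminus Zp_power s)
    then show "qcong p 3 (of_nat p ^ 2 * (- (s ^ 2) * (\<Sum>k=1..p - 1. 1 / of_nat k ^ 3))) (of_nat p ^ 2 * (- (s ^ 2) * 0))"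
      by simp
  qed
  finally show ?thesis by (simp add: power2_eq_square mult_ac)
qed

lemma shift_unit:
  assumes "s \<in> Zp p" "0 < j" "j < p"
  shows "of_nat p * s + of_nat j \<in> Zp p" "\<not> qcong p 1 (of_nat p * s + of_nat j) 0"
    "qcong p 1 (of_nat p * s + of_nat j) (of_nat j)"
proof -
  show "of_nat p * s + of_nat j \<in> Zp p" using assms(1) by auto
  show *: "qcong p 1 (of_nat p * s + of_nat j) (of_nat j)"
    using qcong_add[OF qcong_power_p_zero[OF assms(1), of 1] qcong_refl[of 1 "of_nat j"]] by simp
  show "\<not> qcong p 1 (of_nat p * s + of_nat j) 0"
    using not_qcong_0_cong[OF *] not_qcong_0_of_nat[OF not_p_dvd[OF assms(2,3)]] by blast
qed

lemma binomial_sum_shift: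
  assumes s: "s \<in> Zp p" and "r < p"
  shows "binomial_sum (of_nat p * s + of_nat r) = binomial_sum (of_nat p * s) +
    (\<Sum>j=1..r. 2 / (of_nat p * s + of_nat j) * (wallis_prod (p - 1) (of_nat p * s + of_nat j) - 1))"
  using assms(2)
proof (induction r)
  case (Suc r)
  let ?x = "of_nat p * s + of_nat (Suc r)"
  have "?x \<noteq> 0" using shift_unit(2)[OF s, of "Suc r"] Suc.prems by (metis qcong_refl zero_less_Suc)
  then have "binomial_sum ?x - binomial_sum (?x - 1) = 2 / ?x * (wallis_prod (p - 1) ?x - 1)"
    unfolding binomial_sum_def by (rule sum_gbinom_pair_diff)
  moreover have "?x - 1 = of_nat p * s + of_nat r" by simp
  ultimately show ?case using Suc by (simp add: algebra_simps)
qed simp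

lemma binomial_sum_cong:
  assumes s: "s \<in> Zp p" and r: "r < p"
  shows "qcong p 3 (binomial_sum (of_nat p * s + of_nat r))
    (- (of_nat p ^ 2 * s * bernoulli (N - 2)) +
      (2 * of_nat p ^ 2 * s * (s + 1) * (\<Sum>j=1..r. 1 / (of_nat p * s + of_nat j) ^ 3)
       - 2 * (\<Sum>j=1..r. 1 / (of_nat p * s + of_nat j))))"
proof -
  let ?y = "\<lambda>j. of_nat p * s + of_nat j"
  have "qcong p 3 (2 / ?y j * (wallis_prod (p - 1) (?y j) - 1))
     (2 * of_nat p ^ 2 * s * (s + 1) * (1 / ?y j ^ 3) - 2 * (1 / ?y j))" if "j \<in> {1..r}" for j
  proof -
    have j: "0 < j" "j < p" using that r by auto
    note inv = Zp_inverse[OF shift_unit(1,2)[OF s j]]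
    have "qcong p 3 (2 * (1 / ?y j) * (wallis_prod (p - 1) (?y j) - 1))
        (2 * (1 / ?y j) * (of_nat p ^ 2 * (s * (s + 1)) / ?y j ^ 2 - 1))"
      by (intro qcong_cmult qcong_diff qcong_refl qcong_wallis_prod_unit[OF s j refl] Zp_mult inv Zp_numeral)
    moreover have "2 * (1 / y) * (of_nat p ^ 2 * (s * (s + 1)) / y ^ 2 - 1)
        = 2 * of_nat p ^ 2 * s * (s + 1) * (1 / y ^ 3) - 2 * (1 / y)" for y :: rat
      by (simp add: power2_eq_square power3_eq_cube diff_divide_distrib right_diff_distrib mult_ac)
    ultimately show ?thesis by simp
  qed
  then have "qcong p 3 (\<Sum>j=1..r. 2 / ?y j * (wallis_prod (p - 1) (?y j) - 1))
     (\<Sum>j=1..r. 2 * of_nat p ^ 2 * s * (s + 1) * (1 / ?y j ^ 3) - 2 * (1 / ?y j))"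
    by (rule qcong_sum)
  also have "(\<Sum>j=1..r. 2 * of_nat p ^ 2 * s * (s + 1) * (1 / ?y j ^ 3) - 2 * (1 / ?y j)) =
     2 * of_nat p ^ 2 * s * (s + 1) * (\<Sum>j=1..r. 1 / ?y j ^ 3) - 2 * (\<Sum>j=1..r. 1 / ?y j)"
    by (simp only: sum_subtractf sum_distrib_left)
  finally show ?thesis
    unfolding binomial_sum_shift[OF assms] by (intro qcong_add binomial_sum_multiple s)
qed

section \<open>The Bernoulli polynomials at -a\<close>

lemma bernpoly_p_minus_3_cong:
  assumes s: "s \<in> Zp p" and r: "r < p"
  shows "qcong p 1 (bernpoly (p - 3) (- (of_nat p * s + of_nat r)))
    (bernoulli (p - 3) - 3 * (\<Sum>j=1..r. 1 / (of_nat p * s + of_nat j) ^ 3))"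
proof -
  let ?y = "\<lambda>j. of_nat p * s + of_nat j"
  have Suc: "p - 3 = Suc (p - 4)" and odd: "odd (p - 4)" using p_gt_3 odd_p by auto
  have m3: "qcong p 1 (of_nat (p - 3)) (- 3)"
    using qcong_diff[OF qcong_power_p_zero[OF Zp_1, of 1] qcong_refl[of 1 3]] p_gt_3 by (simp add: of_nat_diff)
  \<comment> \<open>Modulo p only the leading term p B_{p-4} (-s) could survive, and it vanishes
    because B_{p-4} has odd index and is integral.\<close>
  have "qcong p 1 (bernoulli_integral (p - 4) (of_nat p * - s)) (of_nat p ^ 1 * (bernoulli (p - 4) * - s))"
    using bernoulli_integral_truncate[of 1 "- s" "p - 4"] s by (auto simp: mult_ac)
  also have "qcong p 1 \<dots> 0"
    by (intro qcong_power_p_zero Zp_mult Zp_uminus s Zp_bernoulli_odd odd)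
  finally have "qcong p 1 (bernoulli (p - 3) + of_nat (p - 3) * bernoulli_integral (p - 4) (of_nat p * - s))
      (bernoulli (p - 3) + of_nat (p - 3) * 0)"
    by (intro qcong_add qcong_refl qcong_cmult Zp_of_nat)
  then have base: "qcong p 1 (bernpoly (p - 3) (- (of_nat p * s))) (bernoulli (p - 3))"
    unfolding Suc bernpoly_eq_integral by (simp del: bernoulli.simps of_nat_Suc)
  have "qcong p 1 (?y j ^ (p - 4)) (1 / ?y j ^ 3)" if "j \<in> {1..r}" for j
  proof -
    have j: "0 < j" "j < p" using that r by auto
    note y = shift_unit(1,2)[OF s j]
    have "qcong p 1 ((1 / ?y j) ^ 3 * ?y j ^ (p - 1)) ((1 / ?y j) ^ 3 * 1)"
      using qcong_euler[OF y, of 1] by (intro qcong_cmult Zp_power Zp_inverse y) simp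
    moreover have "?y j ^ (p - 1) = ?y j ^ 3 * ?y j ^ (p - 4)"
      using p_gt_3 by (simp flip: power_add)
    ultimately show ?thesis using Zp_inverse(1)[OF y] by (simp add: power_divide)
  qed
  then have sum: "qcong p 1 (\<Sum>j=1..r. ?y j ^ (p - 4)) (\<Sum>j=1..r. 1 / ?y j ^ 3)"
    by (rule qcong_sum)
  \<comment> \<open>Integrality of the inverse cubes, required by \<open>qcong_mult\<close>, is
    transferred from the congruent sum of positive powers.\<close>
  have "(\<Sum>j=1..r. ?y j ^ (p - 4)) \<in> Zp p"
    using s by (intro Zp_sum Zp_power Zp_add Zp_mult) auto
  then have "(\<Sum>j=1..r. 1 / ?y j ^ 3) \<in> Zp p" using qcong_Zp[OF qcong_sym[OF sum]] by blast
  then have "qcong p 1 (bernpoly (p - 3) (- (of_nat p * s)) + of_nat (p - 3) * (\<Sum>j=1..r. ?y j ^ (p - 4)))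
     (bernoulli (p - 3) + (- 3) * (\<Sum>j=1..r. 1 / ?y j ^ 3))"
    by (intro qcong_add qcong_mult base m3 sum Zp_of_nat)
  moreover have "bernpoly (p - 3) (- (of_nat p * s + of_nat r)) =
      bernpoly (p - 3) (- (of_nat p * s)) + of_nat (p - 3) * (\<Sum>j=1..r. ?y j ^ (p - 4))"
    unfolding Suc by (rule bernpoly_minus_shift[OF odd])
  ultimately show ?thesis by simp
qed

text \<open>Modulo p^3 the expansion at -ps has three terms, with B_n, B_{n-1} and B_{n-2} for n = N
  - 1. The outer two vanish because their indices are odd and exceed 1. The r shifts contribute
  powers with exponent N - 1, that is, inverses.\<close>

lemma bernpoly_N_cong:
  assumes s: "s \<in> Zp p" and r: "r < p"
  shows "qcong p 3 (2 * ((bernpoly N (- (of_nat p * s + of_nat r)) - bernoulli N) / of_nat N))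
    (2 * (\<Sum>j=1..r. 1 / (of_nat p * s + of_nat j)) - of_nat p ^ 2 * s ^ 2 * bernoulli (N - 2))"
proof -
  let ?y = "\<lambda>j. of_nat p * s + of_nat j"
  define n where "n = N - 1"
  have n: "N = Suc n" "odd n" "odd (n - 2)" "n - 2 \<noteq> 1" "n \<noteq> 1" "N - 2 = n - 1" "n \<ge> 99"
    using N_large even_N by (auto simp: n_def)
  have "(bernpoly N (- ?y r) - bernoulli N) / of_nat N =
      bernoulli_integral n (of_nat p * - s) + (\<Sum>j=1..r. ?y j ^ n)"
    unfolding n(1) bernpoly_minus_shift[OF n(2)] unfolding bernpoly_eq_integral
    by (simp add: field_simps del: bernoulli.simps of_nat_Suc)
  then have "2 * ((bernpoly N (- ?y r) - bernoulli N) / of_nat N) =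
      2 * bernoulli_integral n (of_nat p * - s) + 2 * (\<Sum>j=1..r. ?y j ^ n)" by simp
  also have "qcong p 3 \<dots> (- (of_nat p ^ 2 * s ^ 2 * bernoulli (N - 2)) + 2 * (\<Sum>j=1..r. 1 / ?y j))"
  proof (intro qcong_add qcong_cmult Zp_numeral qcong_sum)
    have "bernoulli n = 0" "bernoulli (n - 2) = 0" using n bernoulli_odd by blast+
    then have "qcong p 3 (bernoulli_integral n (of_nat p * - s)) (of_nat n * bernoulli (n - 1) * (of_nat p * - s) ^ 2 / 2)"
      using bernoulli_integral_truncate[of 3 "- s" n] s
      by (auto simp: numeral_3_eq_3 numeral_2_eq_2)
    then have "qcong p 3 (2 * bernoulli_integral n (of_nat p * - s)) (2 * (of_nat n * bernoulli (n - 1) * (of_nat p * - s) ^ 2 / 2))"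
      by (rule qcong_cmult) simp
    \<comment> \<open>Here n = p^2 (p - 1) - 1. Its first part yields p^4 B_{N-2}, split as p^3
      times the integral p B_{N-2}; the -1 leaves the main term.\<close>
    also have "2 * (of_nat n * bernoulli (n - 1) * (of_nat p * - s) ^ 2 / 2) =
        of_nat p ^ 3 * ((of_nat p * bernoulli (n - 1)) * (of_nat (p - 1) * s ^ 2)) - of_nat p ^ 2 * s ^ 2 * bernoulli (N - 2)"
    proof -
      have "(of_nat n :: rat) = of_nat N - 1" unfolding n(1) by simp
      moreover define c :: rat where "c = of_nat (p - 1)"
      ultimately have n_c: "(of_nat n :: rat) = of_nat p ^ 2 * c - 1" by simp
      show ?thesis unfolding n(6) n_c c_def[symmetric]
        by (simp add: field_simps power2_eq_square power3_eq_cube)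
    qed
    also have "qcong p 3 \<dots> (0 - of_nat p ^ 2 * s ^ 2 * bernoulli (N - 2))"
      using Zp_p_times_bernoulli s
      by (intro qcong_diff qcong_refl qcong_power_p_zero Zp_mult[of "of_nat p * bernoulli (n - 1)"]) auto
    finally show "qcong p 3 (2 * bernoulli_integral n (of_nat p * - s)) (- (of_nat p ^ 2 * s ^ 2 * bernoulli (N - 2)))"
      by simp
    fix j assume "j \<in> {1..r}"
    then have j: "0 < j" "j < p" using r by auto
    show "qcong p 3 (?y j ^ n) (1 / ?y j)"
      using qcong_power_N_minus[OF shift_unit(1,2)[OF s j], of 1] by (simp add: n_def)
  qed
  finally show ?thesis by simp
qed

text \<open>By Kummer's congruence B_{p-3}(-a) becomes (3/2) B - 3 H3, which contributes -p^2 s(s +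
  1) B. The quotient at N contributes p^2 s^2 B, and the total -p^2 s B is the value found for the
  sum at ps. The terms in H1 and H3 agree directly.\<close>

lemma binomial_sum_main:
  assumes s: "s \<in> Zp p" and r: "r < p" and a: "a = of_nat p * s + of_nat r"
  shows "qcong p 3 (binomial_sum a)
    (- (2 / 3) * of_nat p ^ 2 * s * (s + 1) * bernpoly (p - 3) (- a)
     - 2 * ((bernpoly N (- a) - bernoulli N) / of_nat N))"
proof -
  let ?P = "of_nat p ^ 2 :: rat"
  define B where "B = bernoulli (N - 2)"
  define H1 where "H1 = (\<Sum>j=1..r. 1 / (of_nat p * s + of_nat j))"
  define H3 where "H3 = (\<Sum>j=1..r. 1 / (of_nat p * s + of_nat j) ^ 3)"
  have "qcong p 1 (3 * B) (2 * bernoulli (p - 3))" unfolding B_def by (rule bernoulli_kummer)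
  then have "qcong p 1 (1 / 2 * (3 * B) - 3 * H3) (1 / 2 * (2 * bernoulli (p - 3)) - 3 * H3)"
    by (intro qcong_diff qcong_refl qcong_cmult Zp_half)
  also have "qcong p 1 (1 / 2 * (2 * bernoulli (p - 3)) - 3 * H3) (bernpoly (p - 3) (- a))"
    using qcong_sym[OF bernpoly_p_minus_3_cong[OF s r]] by (simp add: a H3_def)
  finally have "qcong p (2 + 1) (?P * ((- (2 * (1 / 3)) * (s * (s + 1))) * (1 / 2 * (3 * B) - 3 * H3)))
      (?P * ((- (2 * (1 / 3)) * (s * (s + 1))) * bernpoly (p - 3) (- a)))"
    unfolding qcong_shift using s Zp_third
    by (intro qcong_cmult Zp_mult Zp_uminus Zp_add) auto
  then have first: "qcong p 3 (?P * ((- (2 * (1 / 3)) * (s * (s + 1))) * (1 / 2 * (3 * B) - 3 * H3)))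
      (?P * ((- (2 * (1 / 3)) * (s * (s + 1))) * bernpoly (p - 3) (- a)))"
    by (simp only: one_add_one add_2_eq_Suc numeral_3_eq_3) simp
  have second: "qcong p 3 (2 * H1 - ?P * s ^ 2 * B) (2 * ((bernpoly N (- a) - bernoulli N) / of_nat N))"
    unfolding a B_def H1_def by (rule qcong_sym[OF bernpoly_N_cong[OF s r]])
  have "qcong p 3 (binomial_sum a) (- (?P * s * B) + (2 * ?P * s * (s + 1) * H3 - 2 * H1))"
    unfolding a B_def H1_def H3_def by (rule binomial_sum_cong[OF s r])
  also have "- (?P * s * B) + (2 * ?P * s * (s + 1) * H3 - 2 * H1) =
      ?P * ((- (2 * (1 / 3)) * (s * (s + 1))) * (1 / 2 * (3 * B) - 3 * H3)) - (2 * H1 - ?P * s ^ 2 * B)"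
    by (simp add: field_simps power2_eq_square)
  also have "qcong p 3 \<dots> (?P * ((- (2 * (1 / 3)) * (s * (s + 1))) * bernpoly (p - 3) (- a)) -
      2 * ((bernpoly N (- a) - bernoulli N) / of_nat N))"
    by (rule qcong_diff[OF first second])
  also have "?P * ((- (2 * (1 / 3)) * (s * (s + 1))) * bernpoly (p - 3) (- a)) =
      - (2 / 3) * ?P * s * (s + 1) * bernpoly (p - 3) (- a)"
    by simp
  finally show ?thesis .
qed

end

theorem theorem5p1:
  fixes p :: nat and a t :: rat
  assumes "prime p" and "p > 3"
    and "a \<in> Zp p" and "\<not> qcong p 1 a 0"
    and "t = (a - of_int (least_residue p a)) / of_nat p"
  shows "qcong p 3
    (\<Sum>k=1..p-1. 1 / of_nat k * (a gchoose k) * ((- 1 - a) gchoose k))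
    (- (2 / 3) * of_nat p ^ 2 * t * (t + 1) * bernpoly (p - 3) (- a)
     - 2 * ((bernpoly (p ^ 2 * (p - 1)) (- a) - bernoulli (p ^ 2 * (p - 1)))
            / of_nat (p ^ 2 * (p - 1))))"
proof -
  interpret prime_gt_3 p by unfold_locales fact+
  have "0 \<le> least_residue p a \<and> least_residue p a < int p \<and> qcong p 1 a (of_int (least_residue p a))"
    unfolding least_residue_def by (rule theI'[OF least_residue_ex1[OF assms(1,3)]])
  then obtain r where r: "least_residue p a = int r" "r < p" "qcong p 1 a (of_nat r)"
    by (metis of_int_of_nat_eq of_nat_less_iff zero_le_imp_eq_int)
  \<comment> \<open>The quotient in the congruence between a and r modulo p is t itself.\<close>
  have "t \<in> Zp p" using r(3) by (simp add: assms(5) r(1) qcong_def)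
  moreover have "a = of_nat p * t + of_nat r" by (simp add: assms(5) r(1))
  ultimately show ?thesis
    using binomial_sum_main[OF _ r(2)] by (simp only: binomial_sum_def gbinom_pair_def mult.assoc)
qed

end
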